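(* (Local existence and uniqueness.) Let $\alpha\in(\frac13,\frac12]$, $T>0$, let $V,W,U$ be Banach spaces, let $\mathbf X=(1,X,\mathbb X)\in\mathcal D^\alpha(\Delta_T,V)$, $\mathbf Z=(Z,Z')\in\mathcal C^\alpha_{\mathbf X}([0,T],U)$, $F\in C^3_b(W,\mathcal L(U,W))$, and let an initial value $Y_0\in W$ be given. Then for all sufficiently small $\tau\in(0,T)$ there exists a unique controlled solution $\mathbf Y=(Y,Y')\in\mathcal C^\alpha_{\mathbf X}([0,\tau],W)$ with initial value $Y_0$ of $$Y_t=Y_0+\int_0^tF(Y_r)\,d\mathbf Z_r,\qquad t\in[0,\tau],$$ that is, a unique $\mathbf Y=(Y,Y')\in\mathcal C^\alpha_{\mathbf X}([0,\tau],W)$ such that $(Y_t,Y'_t)=\big(Y_0+\int_0^tF(Y_r)\,d\mathbf Z_r,\;F(Y_t)Z'_t\big)$ for all $t\in[0,\tau]$.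
   Context: All Banach spaces are real; tensor products of Banach spaces carry a fixed admissible cross norm and are completed (for definiteness one may take the projective tensor norm throughout). $\mathcal L(A,B)$ is the space of bounded linear maps. For a path $X$, $X_{s,t}:=X_t-X_s$. $\Delta_T:=\{(s,t):0\le s\le t\le T\}$. $C^m_b(A,B)$ is the space of $m$ times continuously differentiable maps $F:A\to B$ with $\|F\|_\infty+\|DF\|_\infty+\dots+\|D^mF\|_\infty<\infty$. Rough path: for $\alpha\in(\frac13,\frac12]$, $\mathbf X=(1,X,\mathbb X):\Delta_T\to\mathbb R\oplus V\oplus V^{\otimes2}$ belongs to $\mathcal D^\alpha(\Delta_T,V)$ if Chen's relation holds, i.e. $X_{s,t}=X_{s,u}+X_{u,t}$ and $\mathbb X_{s,t}=\mathbb X_{s,u}+\mathbb X_{u,t}+X_{s,u}\otimes X_{u,t}$ for $s\le u\le t$, and $\sup_{s\ne t}\frac{|X_{s,t}|}{|t-s|^\alpha}<\infty$, $\sup_{s\neq t}\frac{|\mathbb X_{s,t}|}{|t-s|^{2\alpha}}<\infty$. Controlled rough path: for a Banach space $E$ and $\tau\in(0,T]$, $\mathcal C^\alpha_{\mathbf X}([0,\tau],E)$ is the set of $\mathbf Y=(Y,Y'):[0,\tau]\to E\times\mathcal L(V,E)$ such that, with $R^{0,\mathbf Y}_{s,t}:=Y_{s,t}-Y'_sX_{s,t}$ and $R^{1,\mathbf Y}_{s,t}:=Y'_t-Y'_s$, one has $\sup_{s\ne t}\frac{|R^{0,\mathbf Y}_{s,t}|}{|t-s|^{2\alpha}}<\infty$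 and $\sup_{s\ne t}\frac{|R^{1,\mathbf Y}_{s,t}|}{|t-s|^{\alpha}}<\infty$ (suprema over $s,t\in[0,\tau]$). Rough integral: for $\mathbf G=(G,G')$ controlled with values in $\mathcal L(U,W)$ and $\mathbf Z$ controlled with values in $U$, $\int_s^tG_r\,d\mathbf Z_r:=\lim_{|\pi|\to0}\sum_{[u,v]\in\pi}\big(G_uZ_{u,v}+G'_uZ'_u\mathbb X_{u,v}\big)\in W$, over partitions $\pi$ of $[s,t]$ (this limit is known to exist), where $G'_uZ'_u$ acts on $V\otimes V$ as the linear extension of $x_1\otimes x_2\mapsto[G'_u(x_1)](Z'_u(x_2))$. The integrand $F(Y)$ is understood as the $\mathbf X$-controlled rough path $F(\mathbf Y):=(F(Y),DF(Y)Y')$. *)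

theory Defs
  imports "HOL-Analysis.Analysis"
begin

text \<open>
  A list of pairs stands for the finite sum of the tensors of its entries. The algebraic tensor
  product is realised as usual inside the dual of the bilinear forms, so two finite sums are the
  same element iff all (not necessarily bounded) bilinear forms agree on them.
\<close>

definition alg_tensor_eq :: "('a::real_vector \<times> 'b::real_vector) list \<Rightarrow> ('a \<times> 'b) list \<Rightarrow> bool" where
  "alg_tensor_eq ps qs \<longleftrightarrow>
     (\<forall>B :: 'a \<Rightarrow> 'b \<Rightarrow> real. bilinear B \<longrightarrow> (\<Sum>(x, y)\<leftarrow>ps. B x y) = (\<Sum>(x, y)\<leftarrow>qs. B x y))"

definition projective_norm :: "('a::real_normed_vector \<times> 'b::real_normed_vector) list \<Rightarrow> real" where
  "projective_norm ps = Inf {\<Sum>(x, y)\<leftarrow>qs. norm x * norm y | qs. alg_tensor_eq qs ps}"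

text \<open>
  There is no fixed tensor product type here: the completed projective tensor product of two spaces
  is any Banach space \<open>'t\<close> with a bilinear map whose finite sums are dense and carry the
  projective norm; this determines \<open>'t\<close> up to isometric isomorphism.
\<close>

definition projective_tensor ::
    "('a::real_normed_vector \<Rightarrow> 'b::real_normed_vector \<Rightarrow> 't::banach) \<Rightarrow> bool" where
  "projective_tensor tens \<longleftrightarrow>
     bilinear tens \<and>
     (\<forall>ps. norm (\<Sum>(x, y)\<leftarrow>ps. tens x y) = projective_norm ps) \<and>
     closure (span {tens x y | x y. True}) = UNIV"

definition tensor_lift ::
    "('a::real_normed_vector \<Rightarrow> 'b::real_normed_vector \<Rightarrow> 't::banach) \<Rightarrow>
     ('a \<Rightarrow> 'b \<Rightarrow> 'c::real_normed_vector) \<Rightarrow> 't \<Rightarrow>\<^sub>L 'c" where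
  "tensor_lift tens B = (THE L. \<forall>x y. blinfun_apply L (tens x y) = B x y)"

definition frechet_D ::
    "('a::real_normed_vector \<Rightarrow> 'b::real_normed_vector) \<Rightarrow> 'a \<Rightarrow> 'a \<Rightarrow>\<^sub>L 'b" where
  "frechet_D F x = Blinfun (frechet_derivative F (at x))"

definition C3_b :: "('a::real_normed_vector \<Rightarrow> 'b::real_normed_vector) \<Rightarrow> bool" where
  "C3_b F \<longleftrightarrow>
     (\<forall>x. F differentiable (at x)) \<and>
     (\<forall>x. frechet_D F differentiable (at x)) \<and>
     (\<forall>x. frechet_D (frechet_D F) differentiable (at x)) \<and>
     continuous_on UNIV (frechet_D (frechet_D (frechet_D F))) \<and>
     bounded (range F) \<and>
     bounded (range (frechet_D F)) \<and>
     bounded (range (frechet_D (frechet_D F))) \<and>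
     bounded (range (frechet_D (frechet_D (frechet_D F))))"

definition holder_finite :: "real \<Rightarrow> real \<Rightarrow> (real \<Rightarrow> real \<Rightarrow> 'a::real_normed_vector) \<Rightarrow> bool" where
  "holder_finite \<beta> \<tau> R \<longleftrightarrow>
     bdd_above {norm (R s t) / (t - s) powr \<beta> | s t. 0 \<le> s \<and> s < t \<and> t \<le> \<tau>}"

text \<open>
  A rough path is given by its two non-trivial levels, which are functions of two times; only
  their values at \<open>0 \<le> s \<le> t \<le> T\<close> are relevant.
\<close>

definition rough_path ::
    "('v::banach \<Rightarrow> 'v \<Rightarrow> 't::banach) \<Rightarrow> real \<Rightarrow> real \<Rightarrow>
     (real \<Rightarrow> real \<Rightarrow> 'v) \<Rightarrow> (real \<Rightarrow> real \<Rightarrow> 't) \<Rightarrow> bool" where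
  "rough_path tens \<alpha> T X XX \<longleftrightarrow>
     (\<forall>s u t. 0 \<le> s \<and> s \<le> u \<and> u \<le> t \<and> t \<le> T \<longrightarrow>
        X s t = X s u + X u t \<and>
        XX s t = XX s u + XX u t + tens (X s u) (X u t)) \<and>
     holder_finite \<alpha> T X \<and>
     holder_finite (2 * \<alpha>) T XX"

text \<open>
  The first remainder is only taken at \<open>s < t\<close>, where \<open>X s t\<close> is meaningful. Given the second
  bound and the Hoelder bound on \<open>X\<close>, finiteness for \<open>s > t\<close> (with \<open>X s t = - X t s\<close>) follows.
\<close>

definition controlled ::
    "real \<Rightarrow> (real \<Rightarrow> real \<Rightarrow> 'v::banach) \<Rightarrow> real \<Rightarrow>
     (real \<Rightarrow> 'e::banach) \<Rightarrow> (real \<Rightarrow> 'v \<Rightarrow>\<^sub>L 'e) \<Rightarrow> bool" where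
  "controlled \<alpha> X \<tau> Y Y' \<longleftrightarrow>
     holder_finite (2 * \<alpha>) \<tau> (\<lambda>s t. Y t - Y s - blinfun_apply (Y' s) (X s t)) \<and>
     holder_finite \<alpha> \<tau> (\<lambda>s t. Y' t - Y' s)"

text \<open>A partition of \<open>[s, t]\<close> is the increasing list of its points.\<close>

definition partition_of :: "real \<Rightarrow> real \<Rightarrow> real list \<Rightarrow> bool" where
  "partition_of s t ps \<longleftrightarrow> ps \<noteq> [] \<and> hd ps = s \<and> last ps = t \<and> sorted_wrt (<) ps"

definition partitions :: "real \<Rightarrow> real \<Rightarrow> real list filter" where
  "partitions s t =
     (INF \<delta>\<in>{0<..}. principal {ps. partition_of s t ps \<and> (\<forall>(u, v)\<in>set (zip ps (tl ps)). v - u < \<delta>)})"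

definition rough_integral ::
    "('v::banach \<Rightarrow> 'v \<Rightarrow> 't::banach) \<Rightarrow> (real \<Rightarrow> real \<Rightarrow> 't) \<Rightarrow>
     (real \<Rightarrow> 'u::banach \<Rightarrow>\<^sub>L 'w::banach) \<Rightarrow> (real \<Rightarrow> 'v \<Rightarrow>\<^sub>L 'u \<Rightarrow>\<^sub>L 'w) \<Rightarrow>
     (real \<Rightarrow> 'u) \<Rightarrow> (real \<Rightarrow> 'v \<Rightarrow>\<^sub>L 'u) \<Rightarrow> real \<Rightarrow> real \<Rightarrow> 'w" where
  "rough_integral tens XX G G' Z Z' s t =
     Lim (partitions s t) (\<lambda>ps. \<Sum>(u, v)\<leftarrow>zip ps (tl ps).
       blinfun_apply (G u) (Z v - Z u) +
       blinfun_apply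
         (tensor_lift tens (\<lambda>x1 x2. blinfun_apply (blinfun_apply (G' u) x1) (blinfun_apply (Z' u) x2)))
         (XX u v))"

definition controlled_solution ::
    "('v::banach \<Rightarrow> 'v \<Rightarrow> 't::banach) \<Rightarrow> real \<Rightarrow> (real \<Rightarrow> real \<Rightarrow> 'v) \<Rightarrow> (real \<Rightarrow> real \<Rightarrow> 't) \<Rightarrow>
     (real \<Rightarrow> 'u::banach) \<Rightarrow> (real \<Rightarrow> 'v \<Rightarrow>\<^sub>L 'u) \<Rightarrow> ('w::banach \<Rightarrow> 'u \<Rightarrow>\<^sub>L 'w) \<Rightarrow> 'w \<Rightarrow> real \<Rightarrow>
     (real \<Rightarrow> 'w) \<Rightarrow> (real \<Rightarrow> 'v \<Rightarrow>\<^sub>L 'w) \<Rightarrow> bool" where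
  "controlled_solution tens \<alpha> X XX Z Z' F Y0 \<tau> Y Y' \<longleftrightarrow>
     controlled \<alpha> X \<tau> Y Y' \<and>
     (\<forall>t\<in>{0..\<tau>}.
        Y t = Y0 + rough_integral tens XX
          (\<lambda>r. F (Y r)) (\<lambda>r. frechet_D F (Y r) o\<^sub>L Y' r) Z Z' 0 t \<and>
        Y' t = F (Y t) o\<^sub>L Z' t)"

end

theory Submission imports Defs begin

text \<open>
  For a controlled pair \<open>(G, G')\<close> the germ \<open>A s t = G s (Z t - Z s) + (G' s Z' s) (XX s t)\<close> has defect
  \<open>A s t - A s u - A u t\<close> of order \<open>3 * \<alpha> > 1\<close> by Chen's relation, so by sewing there is a path \<open>I\<close>
  with \<open>I t - I s - A s t\<close> of the same order. Conversely, any such path is the limit of the Riemann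
  sums, since the errors of the pieces add up to something that vanishes with the mesh. Hence a
  solution is the same as a path with \<open>Y t - Y s - A s t\<close> of order \<open>3 * \<alpha>\<close> for the germ of \<open>F (Y)\<close>
  and \<open>Y' = F (Y) Z'\<close>. The germ is linear in \<open>(G, G')\<close>, so the same defect estimate applied to
  \<open>F (Y) - F (V)\<close> shows that \<open>Y \<mapsto> Y0 + \<integral> F (Y) dZ\<close> contracts the Hoelder distance of two controlled
  paths with the same start on a short interval. The Picard iterates therefore converge pointwise,
  and the order \<open>3 * \<alpha>\<close> characterisation passes to the limit. For uniqueness the contraction is
  iterated along subintervals whose length depends on the norms of the two solutions.
\<close>

section \<open>Lifting bounded bilinear maps to the projective tensor product\<close>

text \<open>The delicate point is to gain the factor 1/2 without lowering the Hoelder exponent.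
  Distances are measured by the two seminorms of the difference alone. If the difference and its
  derivative vanish at the left end, then its size, the size of its derivative and its
  \<alpha>-increments all gain a factor \<open>(b - a) powr \<alpha>\<close>. After applying
  \<open>F\<close> and integrating, every term contains one of these small quantities, except the
  sewing error, which has order \<open>3 * \<alpha>\<close> and so one factor more than a remainder
  of order \<open>2 * \<alpha>\<close> needs. Paths to be compared must therefore share the start of
  the path and of the derivative, which dictates the first Picard iterate. Third derivatives enter
  because the difference of two Taylor remainders has to be linear in the distance and quadratic in
  the time increments; this costs a Lipschitz bound on the second derivative. All constants are
  crude powers of one bound that is at least 1. Since \<open>tensor_lift\<close> is a definite
  description, existence and uniqueness of lifts have to be settled before any germ can be
  estimated.\<close>

lemma bilinear_sum_alg_tensor_eq:
  fixes B :: "'a::real_vector \<Rightarrow> 'b::real_vector \<Rightarrow> 'c::real_vector"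
  assumes B: "bilinear B" and eq: "alg_tensor_eq ps qs"
  shows "(\<Sum>(x, y)\<leftarrow>ps. B x y) = (\<Sum>(x, y)\<leftarrow>qs. B x y)"
proof (rule ccontr)
  let ?S = "\<lambda>ps. \<Sum>(x, y)\<leftarrow>ps. B x y"
  assume "?S ps \<noteq> ?S qs"
  \<comment> \<open>A nonzero vector is sent to 1 by some linear functional. It may be
    discontinuous, because \<open>alg_tensor_eq\<close> tests against all bilinear forms.\<close>
  then have "independent {?S ps - ?S qs}"
    by simp
  then obtain f :: "'c \<Rightarrow> real" where f: "linear f" "f (?S ps - ?S qs) = 1"
    using linear_independent_extend[of "{?S ps - ?S qs}" "\<lambda>_. 1"] by auto
  have "bilinear (\<lambda>x y. f (B x y))"
    using B f(1) unfolding bilinear_def by (auto intro: linear_compose[unfolded comp_def])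
  then have "(\<Sum>(x, y)\<leftarrow>ps. f (B x y)) = (\<Sum>(x, y)\<leftarrow>qs. f (B x y))"
    using eq unfolding alg_tensor_eq_def by blast
  moreover have "f (?S rs) = (\<Sum>(x, y)\<leftarrow>rs. f (B x y))" for rs
    by (induction rs) (auto simp: linear_0[OF f(1)] linear_add[OF f(1)])
  ultimately show False
    using f by (simp add: linear_diff)
qed

text \<open>All representations of one tensor give the same value of \<open>B\<close>, so the
  triangle inequality, applied to each of them, survives the infimum. The case \<open>K = 0\<close>
  is split off in order to divide by \<open>K\<close>.\<close>

lemma norm_bilinear_sum_le_projective_norm:
  fixes B :: "'a::real_normed_vector \<Rightarrow> 'b::real_normed_vector \<Rightarrow> 'c::real_normed_vector"
  assumes B: "bilinear B" and le: "\<And>x y. norm (B x y) \<le> K * (norm x * norm y)" and K: "0 \<le> K"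
  shows "norm (\<Sum>(x, y)\<leftarrow>ps. B x y) \<le> K * projective_norm ps"
proof -
  define N where "N = (\<lambda>qs. \<Sum>(x, y)\<leftarrow>qs. norm (x::'a) * norm (y::'b))"
  have N: "norm (\<Sum>(x, y)\<leftarrow>qs. B x y) \<le> K * N qs" for qs
  proof (induction qs)
    case (Cons p qs)
    obtain x y where p: "p = (x, y)" by force
    have "norm (\<Sum>(x, y)\<leftarrow>p # qs. B x y) \<le> norm (B x y) + norm (\<Sum>(x, y)\<leftarrow>qs. B x y)"
      by (simp add: p norm_triangle_ineq)
    also have "\<dots> \<le> K * (norm x * norm y) + K * N qs"
      by (intro add_mono le Cons)
    finally show ?case by (simp add: p N_def distrib_left)
  qed (simp add: N_def)
  show ?thesis
  proof (cases "K = 0")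
    case True
    then show ?thesis using N[of ps] by simp
  next
    case False
    with K have K: "0 < K" by simp
    have "norm (\<Sum>(x, y)\<leftarrow>ps. B x y) / K \<le> projective_norm ps"
      unfolding projective_norm_def
    proof (rule cInf_greatest)
      show "{\<Sum>(x, y)\<leftarrow>qs. norm x * norm y | qs. alg_tensor_eq qs ps} \<noteq> {}"
        using alg_tensor_eq_def by blast
    next
      fix r assume "r \<in> {\<Sum>(x, y)\<leftarrow>qs. norm x * norm y | qs. alg_tensor_eq qs ps}"
      then obtain qs where "r = N qs" "alg_tensor_eq qs ps"
        unfolding N_def by blast
      then show "norm (\<Sum>(x, y)\<leftarrow>ps. B x y) / K \<le> r"
        using N[of qs] bilinear_sum_alg_tensor_eq[OF B] K by (simp add: field_simps)
    qed
    then show ?thesis using K by (simp add: field_simps)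
  qed
qed

text \<open>The pure tensors span a dense subspace and equalizers of continuous maps are closed.
  This justifies the definite description in \<open>tensor_lift\<close>, and it is how identities
  between lifts are checked.\<close>

lemma tensor_lift_unique:
  assumes tens: "projective_tensor tens"
    and L: "\<And>x y. blinfun_apply L (tens x y) = blinfun_apply L' (tens x y)"
  shows "L = L'"
proof (rule blinfun_eqI)
  fix t
  let ?S = "span {tens x y | x y. True}"
  have S: "blinfun_apply L s = blinfun_apply L' s" if "s \<in> ?S" for s
    by (rule linear_eq_on_span[OF _ _ _ that])
      (auto simp: L intro: bounded_linear.linear blinfun.bounded_linear_right)
  have "closed {s. blinfun_apply L s = blinfun_apply L' s}"
    by (intro closed_Collect_eq continuous_intros)
  then have "closure ?S \<subseteq> {s. blinfun_apply L s = blinfun_apply L' s}"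
    using S by (intro closure_minimal) auto
  then show "blinfun_apply L t = blinfun_apply L' t"
    using tens unfolding projective_tensor_def by auto
qed

text \<open>On finite sums the lift is computed from a representing list. The projective norm makes
  it Lipschitz there, hence independent of the list and uniformly extendable to the closure.\<close>

lemma tensor_lift_exists:
  fixes tens :: "'a::real_normed_vector \<Rightarrow> 'b::real_normed_vector \<Rightarrow> 't::banach"
    and B :: "'a \<Rightarrow> 'b \<Rightarrow> 'c::banach"
  assumes tens: "projective_tensor tens" and B: "bilinear B"
    and le: "\<And>x y. norm (B x y) \<le> K * (norm x * norm y)" and K: "0 \<le> K"
  shows "\<exists>L. (\<forall>x y. blinfun_apply L (tens x y) = B x y) \<and> norm L \<le> K"
proof -
  let ?S = "span {tens x y | x y. True}"
  define \<sigma> where "\<sigma> = (\<lambda>ps. \<Sum>(x, y)\<leftarrow>ps. tens x y)"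
  define \<beta> where "\<beta> = (\<lambda>ps. \<Sum>(x, y)\<leftarrow>ps. B x y)"
  have bt: "bilinear tens" using tens unfolding projective_tensor_def by blast
  \<comment> \<open>Scalars act on the left factors. With the scalar -1 a difference of two sums
    becomes a single list, which turns \<open>bound\<close> into \<open>lip\<close>.\<close>
  define sc where "sc = (\<lambda>c. map (\<lambda>(x::'a, y::'b). (c *\<^sub>R x, y)))"
  have app: "\<sigma> (ps @ qs) = \<sigma> ps + \<sigma> qs" "\<beta> (ps @ qs) = \<beta> ps + \<beta> qs" for ps qs
    by (simp_all add: \<sigma>_def \<beta>_def)
  have scl: "\<sigma> (sc c ps) = c *\<^sub>R \<sigma> ps" "\<beta> (sc c ps) = c *\<^sub>R \<beta> ps" for c ps
    by (induction ps) (auto simp: \<sigma>_def \<beta>_def sc_def scaleR_add_right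
        bilinear_lmul[OF bt] bilinear_lmul[OF B])
  have bound: "norm (\<beta> ps) \<le> K * norm (\<sigma> ps)" for ps
    using norm_bilinear_sum_le_projective_norm[OF B le K, of ps] tens
    unfolding \<sigma>_def \<beta>_def projective_tensor_def by simp
  have lip: "norm (\<beta> ps - \<beta> qs) \<le> K * norm (\<sigma> ps - \<sigma> qs)" for ps qs
    using bound[of "ps @ sc (-1) qs"] by (simp add: app scl)
  have range: "\<exists>ps. s = \<sigma> ps" if "s \<in> ?S" for s
    using that
  proof (induction rule: span_induct_alt)
    case base
    have "\<sigma> [] = 0" by (simp add: \<sigma>_def)
    then show ?case by metis
  next
    case (step c x y)
    then obtain a b ps where "x = tens a b" "y = \<sigma> ps" by blast
    then have "c *\<^sub>R x + y = \<sigma> ((c *\<^sub>R a, b) # ps)"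
      by (simp add: \<sigma>_def bilinear_lmul[OF bt])
    then show ?case by blast
  qed
  have in_S: "\<sigma> ps \<in> ?S" for ps
  proof (induction ps)
    case (Cons p ps)
    obtain x y where p: "p = (x, y)" by force
    have "\<sigma> (p # ps) = tens x y + \<sigma> ps" by (simp add: \<sigma>_def p)
    moreover have "tens x y \<in> ?S" by (intro span_base) blast
    ultimately show ?case using Cons by (metis span_add)
  qed (simp add: \<sigma>_def span_zero)
  \<comment> \<open>The choice is consistent: by \<open>lip\<close>, lists with equal \<sigma> have
    equal \<beta>.\<close>
  define f where "f = (\<lambda>s. \<beta> (SOME ps. s = \<sigma> ps))"
  have f: "f (\<sigma> ps) = \<beta> ps" for ps
  proof -
    have "\<sigma> ps = \<sigma> (SOME qs. \<sigma> ps = \<sigma> qs)" by (rule someI_ex) blast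
    then show ?thesis using lip[of "SOME qs. \<sigma> ps = \<sigma> qs" ps] by (simp add: f_def)
  qed
  have "uniformly_continuous_on ?S f"
  proof (rule lipschitz_on_uniformly_continuous[of K], rule lipschitz_onI)
    fix s t assume "s \<in> ?S" "t \<in> ?S"
    then obtain ps qs where "s = \<sigma> ps" "t = \<sigma> qs" using range by meson
    then show "dist (f s) (f t) \<le> K * dist s t"
      using lip[of ps qs] f by (simp add: dist_norm)
  qed (fact K)
  then obtain g where g: "uniformly_continuous_on (closure ?S) g" "\<And>s. s \<in> ?S \<Longrightarrow> f s = g s"
    by (rule uniformly_continuous_on_extension_on_closure) blast
  have cl: "closure ?S = UNIV" using tens unfolding projective_tensor_def by blast
  have cont: "continuous_on UNIV g"
    using g(1) cl uniformly_continuous_imp_continuous by metis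
  have gc: "continuous_on A (\<lambda>x. g (h x))" if "continuous_on A h" for A :: "'z::topological_space set" and h
    using continuous_on_compose2[OF cont that] by simp
  have dense: "P x" if "closed {x. P x}" and "\<And>ps. P (\<sigma> ps)" for x P
  proof -
    have "?S \<subseteq> {x. P x}"
    proof
      fix s assume "s \<in> ?S"
      then show "s \<in> {x. P x}" using range[of s] that(2) by blast
    qed
    then show ?thesis using closure_minimal[OF _ that(1)] cl by blast
  qed
  have gs: "g (\<sigma> ps) = \<beta> ps" for ps using g(2)[OF in_S] f by metis
  \<comment> \<open>Density is used twice for additivity, one variable at a time, since it only
    concerns closed conditions on a single point.\<close>
  have add1: "g (\<sigma> ps + y) = g (\<sigma> ps) + g y" for ps y
  proof (rule dense[of "\<lambda>y. g (\<sigma> ps + y) = g (\<sigma> ps) + g y"])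
    show "closed {y. g (\<sigma> ps + y) = g (\<sigma> ps) + g y}"
      by (intro closed_Collect_eq continuous_intros gc)
  qed (metis gs app)
  have add: "g (x + y) = g x + g y" for x y
  proof (rule dense[of "\<lambda>x. g (x + y) = g x + g y"])
    show "closed {x. g (x + y) = g x + g y}"
      by (intro closed_Collect_eq continuous_intros gc)
  qed (rule add1)
  have scale: "g (c *\<^sub>R x) = c *\<^sub>R g x" for c x
  proof (rule dense[of "\<lambda>x. g (c *\<^sub>R x) = c *\<^sub>R g x"])
    show "closed {x. g (c *\<^sub>R x) = c *\<^sub>R g x}"
      by (intro closed_Collect_eq continuous_intros gc)
  qed (metis gs scl)
  have bd: "norm (g x) \<le> K * norm x" for x
  proof (rule dense[of "\<lambda>x. norm (g x) \<le> K * norm x"])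
    show "closed {x. norm (g x) \<le> K * norm x}"
      by (intro closed_Collect_le continuous_intros gc)
  qed (use bound gs in simp)
  have bl: "bounded_linear g"
    using add scale bd by (intro bounded_linear_intro[of g K]) (auto simp: mult.commute)
  have "blinfun_apply (Blinfun g) (tens x y) = B x y" for x y
    using gs[of "[(x, y)]"] by (simp add: bounded_linear_Blinfun_apply[OF bl] \<sigma>_def \<beta>_def)
  moreover have "norm (Blinfun g) \<le> K"
    using bd K by (intro norm_blinfun_bound) (auto simp: bounded_linear_Blinfun_apply[OF bl])
  ultimately show ?thesis by blast
qed

lemma
  fixes tens :: "'a::real_normed_vector \<Rightarrow> 'b::real_normed_vector \<Rightarrow> 't::banach"
    and B :: "'a \<Rightarrow> 'b \<Rightarrow> 'c::banach"
  assumes tens: "projective_tensor tens" and B: "bilinear B"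
    and le: "\<And>x y. norm (B x y) \<le> K * (norm x * norm y)" and K: "0 \<le> K"
  shows tensor_lift_apply: "blinfun_apply (tensor_lift tens B) (tens x y) = B x y"
    and norm_tensor_lift_le: "norm (tensor_lift tens B) \<le> K"
proof -
  obtain L where L: "\<forall>x y. blinfun_apply L (tens x y) = B x y" "norm L \<le> K"
    using tensor_lift_exists[OF assms] by blast
  have "tensor_lift tens B = L"
    unfolding tensor_lift_def
    using L(1) by (intro the_equality tensor_lift_unique[OF tens]) auto
  with L show "blinfun_apply (tensor_lift tens B) (tens x y) = B x y" "norm (tensor_lift tens B) \<le> K"
    by auto
qed

text \<open>This is the operator written as the product of \<open>G'\<close> and \<open>Z'\<close>
  in the rough integral. As a function of \<open>g\<close> and \<open>z\<close> it is itself a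
  bounded bilinear map.\<close>

definition blinfun_tensor ::
    "('a::real_normed_vector \<Rightarrow> 'b::real_normed_vector \<Rightarrow> 't::banach) \<Rightarrow>
     ('a \<Rightarrow>\<^sub>L 'u::real_normed_vector \<Rightarrow>\<^sub>L 'w::banach) \<Rightarrow> ('b \<Rightarrow>\<^sub>L 'u) \<Rightarrow> 't \<Rightarrow>\<^sub>L 'w" where
  "blinfun_tensor tens g z =
     tensor_lift tens (\<lambda>x y. blinfun_apply (blinfun_apply g x) (blinfun_apply z y))"

lemma
  fixes tens :: "'a::real_normed_vector \<Rightarrow> 'b::real_normed_vector \<Rightarrow> 't::banach"
    and g :: "'a \<Rightarrow>\<^sub>L 'u::real_normed_vector \<Rightarrow>\<^sub>L 'w::banach"
  assumes tens: "projective_tensor tens"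
  shows blinfun_tensor_apply:
      "blinfun_apply (blinfun_tensor tens g z) (tens x y)
         = blinfun_apply (blinfun_apply g x) (blinfun_apply z y)"
    and norm_blinfun_tensor_le: "norm (blinfun_tensor tens g z) \<le> norm g * norm z"
proof -
  let ?B = "\<lambda>x y. blinfun_apply (blinfun_apply g x) (blinfun_apply z y)"
  have "bilinear ?B"
    unfolding bilinear_def
    by (auto intro!: linearI simp: blinfun.bilinear_simps)
  moreover have "norm (?B x y) \<le> (norm g * norm z) * (norm x * norm y)" for x y
  proof -
    have "norm (?B x y) \<le> norm (blinfun_apply g x) * norm (blinfun_apply z y)"
      by (rule norm_blinfun)
    also have "\<dots> \<le> (norm g * norm x) * (norm z * norm y)"
      by (intro mult_mono norm_blinfun) auto
    finally show ?thesis by (simp add: ac_simps)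
  qed
  ultimately show "blinfun_apply (blinfun_tensor tens g z) (tens x y) = ?B x y"
    "norm (blinfun_tensor tens g z) \<le> norm g * norm z"
    unfolding blinfun_tensor_def
    using tensor_lift_apply[OF tens, of ?B "norm g * norm z"]
      norm_tensor_lift_le[OF tens, of ?B "norm g * norm z"] by auto
qed

text \<open>Both sides of each linearity law lift the same bilinear map, so uniqueness of lifts
  applies. This is what allows germs to be subtracted and limits to be taken inside them.\<close>

lemma bounded_bilinear_blinfun_tensor:
  fixes tens :: "'a::real_normed_vector \<Rightarrow> 'b::real_normed_vector \<Rightarrow> 't::banach"
  assumes tens: "projective_tensor tens"
  shows "bounded_bilinear
    (blinfun_tensor tens :: ('a \<Rightarrow>\<^sub>L 'u::real_normed_vector \<Rightarrow>\<^sub>L 'w::banach) \<Rightarrow> ('b \<Rightarrow>\<^sub>L 'u) \<Rightarrow> 't \<Rightarrow>\<^sub>L 'w)"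
  by standard
    (auto intro!: tensor_lift_unique[OF tens] exI[of _ 1]
      simp: blinfun_tensor_apply[OF tens] blinfun.bilinear_simps norm_blinfun_tensor_le[OF tens])

section \<open>Differences of Taylor remainders\<close>

lemma frechet_D_has_derivative:
  assumes "f differentiable (at x)"
  shows "(f has_derivative blinfun_apply (frechet_D f x)) (at x)"
proof -
  have "(f has_derivative frechet_derivative f (at x)) (at x)"
    using assms by (simp add: frechet_derivative_works)
  then show ?thesis
    using has_derivative_bounded_linear bounded_linear_Blinfun_apply
    by (metis (no_types) frechet_D_def)
qed

lemma blinfun_derivative_imp_lipschitz:
  assumes der: "\<And>x. (f has_derivative blinfun_apply (f' x)) (at x)"
    and bd: "\<And>x. norm (f' x) \<le> L"
  shows "norm (f x - f y) \<le> L * norm (x - y)"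
  by (rule differentiable_bound[of UNIV f "\<lambda>x. blinfun_apply (f' x)"])
    (auto simp: der bd norm_blinfun.rep_eq[symmetric])

lemma norm_diff_unit_interval_le:
  fixes g :: "real \<Rightarrow> 'a::real_normed_vector"
  assumes der: "\<And>\<mu>. (g has_vector_derivative g' \<mu>) (at \<mu>)"
    and bd: "\<And>\<mu>. \<lbrakk>0 \<le> \<mu>; \<mu> \<le> 1\<rbrakk> \<Longrightarrow> norm (g' \<mu>) \<le> B"
  shows "norm (g 1 - g 0) \<le> B"
proof -
  have "norm (g 1 - g 0) \<le> B * norm (1 - 0 :: real)"
  proof (rule differentiable_bound[of "{0..1}" g "\<lambda>\<mu> h. h *\<^sub>R g' \<mu>"])
    fix \<mu> :: real assume "\<mu> \<in> {0..1}"
    then show "onorm (\<lambda>h. h *\<^sub>R g' \<mu>) \<le> B"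
      using bd[of \<mu>] by (intro onorm_le) (auto simp: mult.commute[of B] intro!: mult_left_mono)
  qed (use der in \<open>auto simp: has_vector_derivative_def intro: has_derivative_at_withinI\<close>)
  then show ?thesis by simp
qed

lemma has_vector_derivative_along_line:
  assumes der: "\<And>x. (f has_derivative blinfun_apply (f' x)) (at x)"
  shows "((\<lambda>\<mu>::real. f (x + \<mu> *\<^sub>R h)) has_vector_derivative blinfun_apply (f' (x + \<mu> *\<^sub>R h)) h) (at \<mu>)"
proof -
  have "((\<lambda>\<mu>::real. x + \<mu> *\<^sub>R h) has_derivative (\<lambda>t. t *\<^sub>R h)) (at \<mu>)"
    by (auto intro!: derivative_eq_intros)
  from has_derivative_compose[OF this der] show ?thesis
    by (simp add: has_vector_derivative_def blinfun.scaleR_right)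
qed

text \<open>Both pairs are joined by segments with a common parameter. The derivative of the
  difference splits into \<open>f'\<close> on the change of the gap and the change of
  \<open>f'\<close> on the old gap, so each term has a factor from the gap; two separate Lipschitz
  estimates would lose it.\<close>

lemma four_point_bound:
  assumes der: "\<And>x. (f has_derivative blinfun_apply (f' x)) (at x)"
    and bd: "\<And>x. norm (f' x) \<le> L"
    and lip: "\<And>x y. norm (f' x - f' y) \<le> L * norm (x - y)"
  shows "norm (f y2 - f v2 - (f y1 - f v1))
    \<le> L * norm (y2 - v2 - (y1 - v1)) + L * norm (y1 - v1) * (norm (y2 - y1) + norm (v2 - v1))"
proof -
  define d1 d2 where "d1 = y1 - v1" and "d2 = y2 - v2"
  define p1 p2 where "p1 = (\<lambda>\<mu>::real. v1 + \<mu> *\<^sub>R d1)" and "p2 = (\<lambda>\<mu>::real. v2 + \<mu> *\<^sub>R d2)"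
  define g where "g = (\<lambda>\<mu>. f (p2 \<mu>) - f (p1 \<mu>))"
  have L: "0 \<le> L" using bd[of 0] norm_ge_zero order_trans by blast
  have "norm (g 1 - g 0) \<le> L * norm (d2 - d1) + L * norm d1 * (norm (y2 - y1) + norm (v2 - v1))"
  proof (rule norm_diff_unit_interval_le)
    fix \<mu> :: real
    show "(g has_vector_derivative (blinfun_apply (f' (p2 \<mu>)) d2 - blinfun_apply (f' (p1 \<mu>)) d1)) (at \<mu>)"
      unfolding g_def p1_def p2_def
      by (intro has_vector_derivative_diff has_vector_derivative_along_line der)
    assume \<mu>: "0 \<le> \<mu>" "\<mu> \<le> 1"
    have "p2 \<mu> - p1 \<mu> = \<mu> *\<^sub>R (y2 - y1) + (1 - \<mu>) *\<^sub>R (v2 - v1)"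
      by (simp add: p1_def p2_def d1_def d2_def algebra_simps)
    also have "norm \<dots> \<le> \<mu> * norm (y2 - y1) + (1 - \<mu>) * norm (v2 - v1)"
      using \<mu> by (intro order_trans[OF norm_triangle_ineq]) auto
    also have "\<dots> \<le> 1 * norm (y2 - y1) + 1 * norm (v2 - v1)"
      using \<mu> by (intro add_mono mult_right_mono) auto
    finally have p: "norm (p2 \<mu> - p1 \<mu>) \<le> norm (y2 - y1) + norm (v2 - v1)" by simp
    have "blinfun_apply (f' (p2 \<mu>)) d2 - blinfun_apply (f' (p1 \<mu>)) d1
        = blinfun_apply (f' (p2 \<mu>)) (d2 - d1) + blinfun_apply (f' (p2 \<mu>) - f' (p1 \<mu>)) d1"
      by (simp add: blinfun.bilinear_simps)
    also have "norm \<dots> \<le> norm (f' (p2 \<mu>)) * norm (d2 - d1) + norm (f' (p2 \<mu>) - f' (p1 \<mu>)) * norm d1"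
      by (intro order_trans[OF norm_triangle_ineq] add_mono norm_blinfun)
    also have "\<dots> \<le> L * norm (d2 - d1) + L * (norm (y2 - y1) + norm (v2 - v1)) * norm d1"
      by (intro add_mono mult_right_mono order_trans[OF lip] mult_left_mono p L bd) auto
    finally show "norm (blinfun_apply (f' (p2 \<mu>)) d2 - blinfun_apply (f' (p1 \<mu>)) d1)
        \<le> L * norm (d2 - d1) + L * norm d1 * (norm (y2 - y1) + norm (v2 - v1))"
      by (simp add: ac_simps)
  qed
  moreover have "g 1 - g 0 = f y2 - f v2 - (f y1 - f v1)"
    by (simp add: g_def p1_def p2_def d1_def d2_def)
  ultimately show ?thesis by (simp add: d1_def d2_def)
qed

text \<open>Along the segments the two Taylor remainders have derivatives
  \<open>f' (p \<mu>) - f' y1\<close> and \<open>f' (q \<mu>) - f' v1\<close>, applied to the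
  increments. Their difference is a four-point expression for \<open>f'\<close>, which is where the
  Lipschitz bound on \<open>f''\<close> is spent.\<close>

lemma taylor_difference_bound:
  assumes der: "\<And>x. (f has_derivative blinfun_apply (f' x)) (at x)"
    and der2: "\<And>x. (f' has_derivative blinfun_apply (f'' x)) (at x)"
    and bd: "\<And>x. norm (f'' x) \<le> L"
    and lip: "\<And>x y. norm (f'' x - f'' y) \<le> L * norm (x - y)"
  shows "norm (f y2 - f y1 - blinfun_apply (f' y1) (y2 - y1) - (f v2 - f v1 - blinfun_apply (f' v1) (v2 - v1)))
    \<le> (L * norm (y2 - v2 - (y1 - v1)) + L * norm (y1 - v1) * (norm (y2 - y1) + norm (v2 - v1))) * norm (y2 - y1)
      + L * norm (v2 - v1) * norm (y2 - v2 - (y1 - v1))"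
proof -
  define hy hv where "hy = y2 - y1" and "hv = v2 - v1"
  have d: "y2 - v2 - (y1 - v1) = hy - hv" by (simp add: hy_def hv_def)
  define p q where "p = (\<lambda>\<mu>::real. y1 + \<mu> *\<^sub>R hy)" and "q = (\<lambda>\<mu>::real. v1 + \<mu> *\<^sub>R hv)"
  define g where "g = (\<lambda>\<mu>. f (p \<mu>) - \<mu> *\<^sub>R blinfun_apply (f' y1) hy
      - (f (q \<mu>) - \<mu> *\<^sub>R blinfun_apply (f' v1) hv))"
  have L: "0 \<le> L" using bd[of 0] norm_ge_zero order_trans by blast
  have lip': "norm (f' x - f' y) \<le> L * norm (x - y)" for x y
    by (rule blinfun_derivative_imp_lipschitz[OF der2 bd])
  have "norm (g 1 - g 0) \<le> (L * norm (hy - hv) + L * norm (y1 - v1) * (norm hy + norm hv)) * norm hy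
      + L * norm hv * norm (hy - hv)"
  proof (rule norm_diff_unit_interval_le)
    fix \<mu> :: real
    let ?g' = "blinfun_apply (f' (p \<mu>)) hy - blinfun_apply (f' y1) hy
        - (blinfun_apply (f' (q \<mu>)) hv - blinfun_apply (f' v1) hv)"
    have lin: "((\<lambda>\<mu>. \<mu> *\<^sub>R c) has_vector_derivative c) (at \<mu>)" for c :: 'b
      by (auto simp: has_vector_derivative_def intro!: derivative_eq_intros)
    show "(g has_vector_derivative ?g') (at \<mu>)"
      unfolding g_def p_def q_def
      by (intro has_vector_derivative_diff has_vector_derivative_along_line der lin)
    assume \<mu>: "0 \<le> \<mu>" "\<mu> \<le> 1"
    have sc: "norm (\<mu> *\<^sub>R x) \<le> norm x" for x :: 'a
      using \<mu> by (simp add: mult_left_le_one_le)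
    have pq: "p \<mu> - q \<mu> - (y1 - v1) = \<mu> *\<^sub>R (hy - hv)" "p \<mu> - y1 = \<mu> *\<^sub>R hy" "q \<mu> - v1 = \<mu> *\<^sub>R hv"
      by (simp_all add: p_def q_def algebra_simps)
    have "norm (f' (p \<mu>) - f' (q \<mu>) - (f' y1 - f' v1))
        \<le> L * norm (\<mu> *\<^sub>R (hy - hv)) + L * norm (y1 - v1) * (norm (\<mu> *\<^sub>R hy) + norm (\<mu> *\<^sub>R hv))"
      using four_point_bound[OF der2 bd lip, of "p \<mu>" "q \<mu>" y1 v1] unfolding pq .
    also have "\<dots> \<le> L * norm (hy - hv) + L * norm (y1 - v1) * (norm hy + norm hv)"
      by (intro add_mono mult_left_mono sc) (auto simp: L)
    finally have 1: "norm (f' (p \<mu>) - f' (q \<mu>) - (f' y1 - f' v1))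
        \<le> L * norm (hy - hv) + L * norm (y1 - v1) * (norm hy + norm hv)" .
    have "norm (f' (q \<mu>) - f' v1) \<le> L * norm (\<mu> *\<^sub>R hv)"
      using lip'[of "q \<mu>" v1] unfolding pq .
    also have "\<dots> \<le> L * norm hv"
      by (intro mult_left_mono sc L)
    finally have 2: "norm (f' (q \<mu>) - f' v1) \<le> L * norm hv" .
    have "?g' = blinfun_apply (f' (p \<mu>) - f' (q \<mu>) - (f' y1 - f' v1)) hy
        + blinfun_apply (f' (q \<mu>) - f' v1) (hy - hv)"
      by (simp add: blinfun.bilinear_simps)
    also have "norm \<dots> \<le> norm (f' (p \<mu>) - f' (q \<mu>) - (f' y1 - f' v1)) * norm hy
        + norm (f' (q \<mu>) - f' v1) * norm (hy - hv)"
      by (intro order_trans[OF norm_triangle_ineq] add_mono norm_blinfun)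
    also have "\<dots> \<le> (L * norm (hy - hv) + L * norm (y1 - v1) * (norm hy + norm hv)) * norm hy
        + L * norm hv * norm (hy - hv)"
      by (intro add_mono mult_right_mono 1 2) auto
    finally show "norm ?g' \<le> \<dots>" .
  qed
  moreover have "g 1 - g 0 = f y2 - f y1 - blinfun_apply (f' y1) (y2 - y1)
      - (f v2 - f v1 - blinfun_apply (f' v1) (v2 - v1))"
    by (simp add: g_def p_def q_def hy_def hv_def)
  ultimately show ?thesis unfolding d by (simp add: hy_def hv_def)
qed

section \<open>The sewing lemma\<close>

text \<open>The fixed point of \<open>k = 2 + k * 2 powr (1 - \<theta>)\<close>: one splitting costs
  two defects, and two rests of at most half the length weigh \<open>2 powr (1 - \<theta>)\<close>
  together, so the constant reproduces itself under induction.\<close>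

definition sewing_const :: "real \<Rightarrow> real" where
  "sewing_const \<theta> = 2 / (1 - 2 powr (1 - \<theta>))"

lemma sewing_const:
  assumes "1 < \<theta>"
  shows "0 < sewing_const \<theta>" "2 + sewing_const \<theta> * 2 powr (1 - \<theta>) = sewing_const \<theta>"
proof -
  have "2 powr (1 - \<theta>) < (2::real) powr 0"
    using assms by (intro powr_less_mono) auto
  then have "2 powr (1 - \<theta>) < (1::real)" by simp
  then show "0 < sewing_const \<theta>" "2 + sewing_const \<theta> * 2 powr (1 - \<theta>) = sewing_const \<theta>"
    by (auto simp: sewing_const_def divide_simps)
qed

lemma norm_diff4_le:
  fixes a b c d :: "'a::real_normed_vector"
  assumes "norm a \<le> A" "norm b \<le> B" "norm c \<le> C" "norm d \<le> D"
  shows "norm (a + b - c - d) \<le> A + B + C + D"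
  using assms by norm

lemma norm_add3_le:
  fixes a b c :: "'a::real_normed_vector"
  assumes "norm a \<le> A" "norm b \<le> B" "norm c \<le> C"
  shows "norm (a + b + c) \<le> A + B + C"
  using assms by norm

lemma two_halves_powr:
  assumes "0 \<le> (l::real)"
  shows "2 * (l / 2) powr \<theta> = 2 powr (1 - \<theta>) * l powr \<theta>"
  using assms by (simp add: powr_divide powr_diff)

locale sewing_germ =
  fixes A :: "real \<Rightarrow> real \<Rightarrow> 'w::banach" and \<theta> C a b :: real
  assumes theta: "1 < \<theta>"
    and C_nonneg: "0 \<le> C"
    and defect: "\<And>s u t. \<lbrakk>a \<le> s; s \<le> u; u \<le> t; t \<le> b\<rbrakk> \<Longrightarrow>
      norm (A s t - A s u - A u t) \<le> C * (t - s) powr \<theta>"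
begin

lemma germ_refl: "a \<le> s \<Longrightarrow> s \<le> b \<Longrightarrow> A s s = 0"
  using defect[of s s s] by simp

text \<open>Only the one piece straddling the midpoint has to be split off; the two rests have at most
  half the length, which is a contraction because of \<open>\<theta> > 1\<close>.\<close>

lemma partition_sum_bound:
  fixes x :: "nat \<Rightarrow> real"
  assumes x: "mono_on {m..n} x" "a \<le> x m" "x n \<le> b" "m \<le> n"
  shows "norm ((\<Sum>k=m..<n. A (x k) (x (Suc k))) - A (x m) (x n))
     \<le> sewing_const \<theta> * C * (x n - x m) powr \<theta>"
  using x
proof (induction "n - m" arbitrary: m n rule: less_induct)
  case less
  let ?S = "\<lambda>m n. \<Sum>k=m..<n. A (x k) (x (Suc k))"
  let ?K = "sewing_const \<theta>"
  have mono: "x i \<le> x j" if "m \<le> i" "i \<le> j" "j \<le> n" for i j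
    using less.prems(1) that unfolding mono_on_def by auto
  show ?case
  proof (cases "m = n")
    case True
    then show ?thesis using less.prems germ_refl[of "x m"] by simp
  next
    case False
    define l where "l = x n - x m"
    define mid where "mid = (x m + x n) / 2"
    \<comment> \<open>The index \<open>n\<close> is left out, so that the maximal \<open>i\<close>
      still has a piece from \<open>x i\<close> to \<open>x (Suc i)\<close>. This piece straddles
      \<open>mid\<close>.\<close>
    define I where "I = {i \<in> {m..<n}. x i \<le> mid}"
    have mn: "x m \<le> x n" using mono[of m n] less.prems by simp
    have "m \<in> I" using False less.prems mn by (auto simp: I_def mid_def)
    then have I: "finite I" "I \<noteq> {}" by (auto simp: I_def)
    define i where "i = Max I"
    have "i \<in> I" using Max_in[OF I] by (simp add: i_def)
    then have i: "m \<le> i" "i < n" "x i \<le> mid" by (auto simp: I_def)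
    have i': "mid \<le> x (Suc i)"
    proof (cases "Suc i = n")
      case True
      then show ?thesis using mn by (simp add: mid_def)
    next
      case False
      have "Suc i \<notin> I" using Max_ge[OF I(1), of "Suc i"] by (auto simp: i_def)
      then show ?thesis using False i by (auto simp: I_def)
    qed
    have pts: "x m \<le> x i" "x i \<le> x (Suc i)" "x (Suc i) \<le> x n"
      using mono[of m i] mono[of i "Suc i"] mono[of "Suc i" n] i by auto
    have mo: "mono_on {m..i} x" "mono_on {Suc i..n} x"
      using less.prems(1) i by (auto intro: mono_on_subset)
    have l0: "0 \<le> l" using mn by (simp add: l_def)
    have b1: "norm (?S m i - A (x m) (x i)) \<le> ?K * C * (x i - x m) powr \<theta>"
      using i pts less.prems mo by (intro less.hyps) auto
    have b2: "norm (?S (Suc i) n - A (x (Suc i)) (x n)) \<le> ?K * C * (x n - x (Suc i)) powr \<theta>"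
      using i pts less.prems mo by (intro less.hyps) auto
    have h1: "(x i - x m) powr \<theta> \<le> (l / 2) powr \<theta>"
      using pts i theta by (intro powr_mono2) (auto simp: l_def mid_def)
    have h2: "(x n - x (Suc i)) powr \<theta> \<le> (l / 2) powr \<theta>"
      using pts i' theta by (intro powr_mono2) (auto simp: l_def mid_def field_simps)
    have KC: "0 \<le> ?K * C" using sewing_const(1)[OF theta] C_nonneg by simp
    have d1: "norm (A (x m) (x n) - A (x m) (x i) - A (x i) (x n)) \<le> C * l powr \<theta>"
      unfolding l_def using pts less.prems by (intro defect) auto
    have "norm (A (x i) (x n) - A (x i) (x (Suc i)) - A (x (Suc i)) (x n)) \<le> C * (x n - x i) powr \<theta>"
      using pts less.prems by (intro defect) auto
    also have "\<dots> \<le> C * l powr \<theta>"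
      using pts theta C_nonneg by (intro mult_left_mono powr_mono2) (auto simp: l_def)
    finally have d2: "norm (A (x i) (x n) - A (x i) (x (Suc i)) - A (x (Suc i)) (x n)) \<le> C * l powr \<theta>" .
    have S: "?S m n = ?S m i + A (x i) (x (Suc i)) + ?S (Suc i) n"
      using i sum.atLeastLessThan_concat[of m i n "\<lambda>k. A (x k) (x (Suc k))"]
        sum.atLeast_Suc_lessThan[of i n "\<lambda>k. A (x k) (x (Suc k))"] by (simp add: add.assoc)
    \<comment> \<open>The interval is cut at \<open>x i\<close> and its right part again at
      \<open>x (Suc i)\<close>. These two defects are the 2 in \<open>sewing_const\<close>.\<close>
    have "?S m n - A (x m) (x n) = (?S m i - A (x m) (x i)) + (?S (Suc i) n - A (x (Suc i)) (x n))
        - (A (x m) (x n) - A (x m) (x i) - A (x i) (x n))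
        - (A (x i) (x n) - A (x i) (x (Suc i)) - A (x (Suc i)) (x n))"
      unfolding S by simp
    also have "norm \<dots> \<le> ?K * C * (x i - x m) powr \<theta> + ?K * C * (x n - x (Suc i)) powr \<theta>
        + C * l powr \<theta> + C * l powr \<theta>"
      by (rule norm_diff4_le[OF b1 b2 d1 d2])
    also have "\<dots> \<le> ?K * C * (l / 2) powr \<theta> + ?K * C * (l / 2) powr \<theta> + C * l powr \<theta> + C * l powr \<theta>"
      using h1 h2 by (intro add_mono mult_left_mono[OF _ KC]) auto
    also have "\<dots> = ?K * C * (2 * (l / 2) powr \<theta>) + 2 * C * l powr \<theta>"
      by (simp only: mult_2 distrib_left distrib_right add.assoc)
    also have "\<dots> = (2 + ?K * 2 powr (1 - \<theta>)) * C * l powr \<theta>"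
      unfolding two_halves_powr[OF l0] by (simp only: distrib_left distrib_right ac_simps)
    finally show ?thesis unfolding sewing_const(2)[OF theta] l_def .
  qed
qed

text \<open>Riemann sums over dyadic grids form a Cauchy sequence, since passing to the next grid
  costs one defect per cell. Up to one further defect the increment of such a sum over
  \<open>[s, t]\<close> is itself a partition sum of \<open>[s, t]\<close>, to which
  \<open>partition_sum_bound\<close> applies.\<close>

lemma sewing_exists:
  assumes "a \<le> b"
  shows "\<exists>I. \<forall>s t. a \<le> s \<and> s \<le> t \<and> t \<le> b \<longrightarrow>
    norm (I t - I s - A s t) \<le> sewing_const \<theta> * C * (t - s) powr \<theta>"
proof -
  define d where "d = (\<lambda>n k. a + (b - a) * real k / 2 ^ n)"
  \<comment> \<open>Cutting the grid points off at \<open>t\<close> makes the cells beyond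
    \<open>t\<close> degenerate, where the germ vanishes. Thus one grid serves all
    \<open>t\<close>.\<close>
  define I where "I = (\<lambda>n t. \<Sum>k<2^n. A (min t (d n k)) (min t (d n (Suc k))))"
  \<comment> \<open>The defects of all \<open>2 ^ n\<close> cells together. They decay geometrically
    because \<theta> exceeds 1.\<close>
  define e where "e = (\<lambda>n::nat. 2 ^ n * (C * ((b - a) / 2 ^ n) powr \<theta>))"
  have e: "e n = C * (b - a) powr \<theta> * (2 powr (1 - \<theta>)) ^ n" for n
  proof -
    have "((2::real) ^ n) powr \<theta> = 2 powr (real n * \<theta>)"
      by (subst powr_realpow[symmetric]) (simp_all add: powr_powr)
    moreover have "((2::real) powr \<theta>) ^ n = 2 powr (\<theta> * real n)"
      by (subst powr_realpow[symmetric]) (simp_all add: powr_powr)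
    ultimately have "((2::real) ^ n) powr \<theta> = (2 powr \<theta>) ^ n"
      by (simp add: mult.commute)
    then show ?thesis
      using assms by (simp add: e_def powr_divide powr_diff power_divide)
  qed
  have geo: "\<bar>2 powr (1 - \<theta>)\<bar> < (1::real)"
    using theta powr_less_mono[of "1 - \<theta>" 0 2] by simp
  have e_lim: "e \<longlonglongrightarrow> 0"
    using tendsto_mult_right_zero[OF LIMSEQ_power_zero[of "2 powr (1 - \<theta>) :: real"], of "C * (b - a) powr \<theta>"] geo
    by (simp add: e[abs_def])
  have e_sum: "summable e"
    using summable_mult[OF summable_geometric[of "2 powr (1 - \<theta>) :: real"], of "C * (b - a) powr \<theta>"] geo
    by (simp add: e[abs_def])
  have d_0: "d n 0 = a" and d_end: "d n (2 ^ n) = b" for n by (simp_all add: d_def)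
  have d_mono: "d n i \<le> d n j" if "i \<le> j" for n i j
    using that assms by (auto simp: d_def divide_right_mono mult_left_mono)
  have d_ge: "a \<le> d n i" for n i using assms by (simp add: d_def)
  have d_le: "d n i \<le> b" if "i \<le> 2 ^ n" for n i using d_mono[OF that, of n] d_end by simp
  have d_step: "d n (Suc k) - d n k = (b - a) / 2 ^ n" for n k
    by (simp add: d_def field_simps)
  have d_even: "d (Suc n) (2 * k) = d n k" for n k
    by (simp add: d_def)
  have sum_e: "norm (\<Sum>k<2^n. f k) \<le> e n"
    if "\<And>k. k < 2 ^ n \<Longrightarrow> norm (f k) \<le> C * ((b - a) / 2 ^ n) powr \<theta>" for f :: "nat \<Rightarrow> 'w" and n
    using sum_norm_bound[of "{..<2 ^ n}" f] that by (simp add: e_def)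
  have I_step: "norm (I (Suc n) t - I n t) \<le> e n" if t: "a \<le> t" "t \<le> b" for n t
  proof -
    let ?x = "\<lambda>k. min t (d (Suc n) k)"
    have "I (Suc n) t = (\<Sum>k<2^n * 2. A (?x k) (?x (Suc k)))"
      by (simp add: I_def mult.commute)
    also have "\<dots> = (\<Sum>m<2^n. \<Sum>k=m*2..<m*2+2. A (?x k) (?x (Suc k)))"
      by (rule sum.nat_group[symmetric])
    also have "\<dots> = (\<Sum>m<2^n. A (?x (2*m)) (?x (2*m+1)) + A (?x (2*m+1)) (?x (2*(Suc m))))"
      by (intro sum.cong) (auto simp: mult.commute numeral_2_eq_2)
    finally have *: "I (Suc n) t - I n t = (\<Sum>m<2^n. A (?x (2*m)) (?x (2*m+1))
         + A (?x (2*m+1)) (?x (2*(Suc m))) - A (?x (2*m)) (?x (2*(Suc m))))"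
      unfolding sum_subtractf by (simp add: I_def d_even del: mult_Suc_right)
    show ?thesis unfolding *
    proof (rule sum_e)
      fix m :: nat assume m: "m < 2 ^ n"
      let ?u = "?x (2*m)" and ?v = "?x (2*m+1)" and ?w = "?x (2*(Suc m))"
      have uw: "?u = min t (d n m)" "?w = min t (d n (Suc m))" by (simp_all only: d_even)
      have "norm (A ?u ?w - A ?u ?v - A ?v ?w) \<le> C * (?w - ?u) powr \<theta>"
      proof (rule defect)
        show "?u \<le> ?v" "?v \<le> ?w" by (intro min.mono d_mono; simp)+
      qed (use t d_ge[of "Suc n" "2*m"] in auto)
      also have "\<dots> \<le> C * ((b - a) / 2 ^ n) powr \<theta>"
        using C_nonneg theta d_step[of n m] d_mono[of m "Suc m" n] unfolding uw
        by (intro mult_left_mono powr_mono2) auto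
      finally show "norm (A ?u ?v + A ?v ?w - A ?u ?w) \<le> C * ((b - a) / 2 ^ n) powr \<theta>"
        using norm_minus_commute[of "A ?u ?w" "A ?u ?v + A ?v ?w"] by (simp only: diff_diff_add)
    qed
  qed
  have conv: "convergent (\<lambda>n. I n t)" if t: "a \<le> t" "t \<le> b" for t
  proof -
    have "summable (\<lambda>n. I (Suc n) t - I n t)"
      using I_step[OF t] by (intro summable_comparison_test'[OF e_sum])
    then have "convergent (\<lambda>n. \<Sum>i<n. I (Suc i) t - I i t)"
      by (simp add: summable_iff_convergent)
    then have "convergent (\<lambda>n. I n t - I 0 t)"
      by (subst (asm) sum_lessThan_telescope)
    then show ?thesis using convergent_add[OF _ convergent_const[of "I 0 t"]] by fastforce
  qed
  have incr: "norm (I n t - I n s - A s t) \<le> e n + sewing_const \<theta> * C * (t - s) powr \<theta>"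
    if st: "a \<le> s" "s \<le> t" "t \<le> b" for n s t
  proof -
    \<comment> \<open>Clamping to \<open>[s, t]\<close> turns the grid into a weakly increasing
      partition of \<open>[s, t]\<close>.\<close>
    define c where "c = (\<lambda>x. max s (min t x))"
    let ?x = "d n"
    have "norm ((\<Sum>k=0..<2^n. A (c (?x k)) (c (?x (Suc k)))) - A (c (?x 0)) (c (?x (2 ^ n))))
        \<le> sewing_const \<theta> * C * (c (?x (2 ^ n)) - c (?x 0)) powr \<theta>"
    proof (rule partition_sum_bound)
      show "mono_on {0..2 ^ n} (\<lambda>k. c (?x k))"
        unfolding mono_on_def c_def using d_mono[of _ _ n] by (meson max.mono min.mono order_refl)
    qed (use st in \<open>auto simp: c_def\<close>)
    moreover have "c (?x 0) = s" "c (?x (2 ^ n)) = t"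
      using st by (simp_all add: c_def d_0 d_end max_def min_def)
    ultimately have p: "norm ((\<Sum>k<2^n. A (c (?x k)) (c (?x (Suc k)))) - A s t)
        \<le> sewing_const \<theta> * C * (t - s) powr \<theta>"
      by (simp add: lessThan_atLeast0)
    have "norm (\<Sum>k<2^n. A (min t (?x k)) (min t (?x (Suc k))) - A (min s (?x k)) (min s (?x (Suc k)))
        - A (c (?x k)) (c (?x (Suc k)))) \<le> e n"
    proof (rule sum_e)
      fix k :: nat assume "k < 2 ^ n"
      then have y: "?x (Suc k) \<le> b" by (intro d_le) simp
      let ?u = "?x k" and ?v = "?x (Suc k)"
      have uv: "a \<le> ?u" "?u \<le> ?v" using d_ge d_mono[of k "Suc k"] by auto
      have nn: "0 \<le> C * ((b - a) / 2 ^ n) powr \<theta>" using C_nonneg by simp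
      have ss: "A s s = 0" using germ_refl st by simp
      \<comment> \<open>Only a cell with \<open>s\<close> in its interior contributes, and then by
        one defect. Allowing this for every cell is crude but still gives the null sequence
        \<open>e\<close>.\<close>
      consider "?v \<le> s" | "s \<le> ?u" | "?u < s" "s < ?v" by linarith
      then show "norm (A (min t ?u) (min t ?v) - A (min s ?u) (min s ?v) - A (c ?u) (c ?v))
          \<le> C * ((b - a) / 2 ^ n) powr \<theta>"
      proof cases
        case 1
        then have "min t ?u = ?u" "min t ?v = ?v" "min s ?u = ?u" "min s ?v = ?v" "c ?u = s" "c ?v = s"
          using st uv by (auto simp: c_def)
        then show ?thesis using ss nn by simp
      next
        case 2
        then have "c ?u = min t ?u" "c ?v = min t ?v" "min s ?u = s" "min s ?v = s"
          using st uv by (auto simp: c_def)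
        then show ?thesis using ss nn by simp
      next
        case 3
        then have *: "min t ?u = ?u" "min s ?u = ?u" "min s ?v = s" "c ?u = s" "c ?v = min t ?v"
          using st uv by (auto simp: c_def)
        have "norm (A ?u (min t ?v) - A ?u s - A s (min t ?v)) \<le> C * (min t ?v - ?u) powr \<theta>"
          using 3 st uv by (intro defect) auto
        also have "\<dots> \<le> C * ((b - a) / 2 ^ n) powr \<theta>"
          using C_nonneg theta d_step[of n k] 3 st by (intro mult_left_mono powr_mono2) auto
        finally show ?thesis unfolding * .
      qed
    qed
    from norm_add3_le[OF this p, of 0 0] show ?thesis
      unfolding I_def sum_subtractf by simp
  qed
  show ?thesis
  proof (intro exI[of _ "\<lambda>t. lim (\<lambda>n. I n t)"] allI impI)
    fix s t assume "a \<le> s \<and> s \<le> t \<and> t \<le> b"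
    then have st: "a \<le> s" "s \<le> t" "t \<le> b" by auto
    have "(\<lambda>n. norm (I n t - I n s - A s t)) \<longlonglongrightarrow>
        norm (lim (\<lambda>n. I n t) - lim (\<lambda>n. I n s) - A s t)"
      using conv[of s] conv[of t] st
      by (intro tendsto_intros) (auto simp: convergent_LIMSEQ_iff)
    moreover have "(\<lambda>n. e n + sewing_const \<theta> * C * (t - s) powr \<theta>) \<longlonglongrightarrow>
        0 + sewing_const \<theta> * C * (t - s) powr \<theta>"
      by (intro tendsto_intros e_lim)
    ultimately show "norm (lim (\<lambda>n. I n t) - lim (\<lambda>n. I n s) - A s t)
        \<le> sewing_const \<theta> * C * (t - s) powr \<theta>"
      using incr[OF st] by (intro LIMSEQ_le[of "\<lambda>n. norm (I n t - I n s - A s t)"]) auto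
  qed
qed

text \<open>Bisecting an interval turns any a priori constant \<open>B\<close> into \<open>C + 2 powr (1 - \<theta>) * B\<close>.\<close>

lemma sewing_bound:
  assumes B: "\<And>s t. \<lbrakk>a \<le> s; s \<le> t; t \<le> b\<rbrakk> \<Longrightarrow> norm (I t - I s - A s t) \<le> B * (t - s) powr \<theta>"
    and st: "a \<le> s" "s \<le> t" "t \<le> b"
  shows "norm (I t - I s - A s t) \<le> sewing_const \<theta> * C * (t - s) powr \<theta>"
proof -
  let ?K = "sewing_const \<theta> * C" and ?q = "2 powr (1 - \<theta>) :: real"
  have *: "norm (I t - I s - A s t) \<le> (?K + ?q ^ n * \<bar>B\<bar>) * (t - s) powr \<theta>"
    if "a \<le> s" "s \<le> t" "t \<le> b" for n s t
    using that
  proof (induction n arbitrary: s t)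
    case 0
    have "norm (I t - I s - A s t) \<le> B * (t - s) powr \<theta>" by (rule B[OF 0])
    also have "\<dots> \<le> (?K + ?q ^ 0 * \<bar>B\<bar>) * (t - s) powr \<theta>"
      using sewing_const(1)[OF theta] C_nonneg mult_nonneg_nonneg[of "sewing_const \<theta>" C]
      by (intro mult_right_mono) (auto intro: order_trans[OF abs_ge_self])
    finally show ?case .
  next
    case (Suc n)
    define m where "m = (s + t) / 2"
    define l where "l = t - s"
    have m: "s \<le> m" "m \<le> t" "m - s = l / 2" "t - m = l / 2" "0 \<le> l"
      using Suc.prems by (auto simp: m_def l_def field_simps)
    let ?D = "?K + ?q ^ n * \<bar>B\<bar>"
    have 1: "norm (I m - I s - A s m) \<le> ?D * (l / 2) powr \<theta>"
      using Suc.IH[of s m] Suc.prems m by simp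
    have 2: "norm (I t - I m - A m t) \<le> ?D * (l / 2) powr \<theta>"
      using Suc.IH[of m t] Suc.prems m by simp
    have 3: "norm (A s t - A s m - A m t) \<le> C * l powr \<theta>"
      unfolding l_def using Suc.prems m by (intro defect) auto
    have "norm (I t - I s - A s t) \<le> ?D * (2 * (l / 2) powr \<theta>) + C * l powr \<theta>"
      using norm_diff4_le[OF 1 2 3, of 0 0] by (simp add: algebra_simps)
    also have "\<dots> = (C + ?q * ?K + ?q ^ Suc n * \<bar>B\<bar>) * l powr \<theta>"
      unfolding two_halves_powr[OF m(5)] by (simp add: algebra_simps)
    \<comment> \<open>Bisection costs a single defect. It is counted twice to reach the fixed-point
      equation of \<open>sewing_const\<close>.\<close>
    also have "\<dots> \<le> (2 * C + ?q * ?K + ?q ^ Suc n * \<bar>B\<bar>) * l powr \<theta>"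
      using C_nonneg by (intro mult_right_mono) auto
    also have "2 * C + ?q * ?K = (2 + sewing_const \<theta> * ?q) * C" by (simp add: algebra_simps)
    finally show ?case unfolding sewing_const(2)[OF theta] l_def .
  qed
  have "\<bar>?q\<bar> < 1"
    using theta powr_less_mono[of "1 - \<theta>" 0 2] by simp
  then have "(\<lambda>n. (?K + ?q ^ n * \<bar>B\<bar>) * (t - s) powr \<theta>) \<longlonglongrightarrow> (?K + 0 * \<bar>B\<bar>) * (t - s) powr \<theta>"
    by (intro tendsto_intros LIMSEQ_power_zero) auto
  then show ?thesis
    using *[OF st] by (intro LIMSEQ_le_const[of "\<lambda>n. (?K + ?q ^ n * \<bar>B\<bar>) * (t - s) powr \<theta>"]) auto
qed

end

section \<open>Partitions and limits of Riemann sums\<close>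

lemma partition_of_pairs:
  assumes "partition_of s t ps" "(u, v) \<in> set (zip ps (tl ps))"
  shows "s \<le> u \<and> u < v \<and> v \<le> t"
  using assms
proof (induction ps arbitrary: s)
  case (Cons p ps)
  show ?case
  proof (cases ps)
    case Nil
    then show ?thesis using Cons.prems by simp
  next
    case ps: (Cons q qs)
    have part: "partition_of q t ps" "s = p" "p < q"
      using Cons.prems ps by (auto simp: partition_of_def split: if_splits)
    consider "u = p" "v = q" | "(u, v) \<in> set (zip ps (tl ps))"
      using Cons.prems(2) ps by auto
    then show ?thesis
    proof cases
      case 1
      have "q \<le> t"
        using part(1) ps last_in_set[of ps] by (auto simp: partition_of_def split: if_splits)
      then show ?thesis using 1 part by simp
    next
      case 2
      then show ?thesis using Cons.IH[OF part(1)] part by auto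
    qed
  qed
qed (simp_all add: partition_of_def)

lemma partition_of_telescope:
  fixes I :: "real \<Rightarrow> 'a::ab_group_add"
  assumes "partition_of s t ps"
  shows "(\<Sum>(u, v)\<leftarrow>zip ps (tl ps). I v - I u) = I t - I s"
  using assms
proof (induction ps arbitrary: s)
  case (Cons p ps)
  show ?case
  proof (cases ps)
    case Nil
    then show ?thesis using Cons.prems by (auto simp: partition_of_def)
  next
    case ps: (Cons q qs)
    have "partition_of q t ps" "s = p"
      using Cons.prems ps by (auto simp: partition_of_def split: if_splits)
    then show ?thesis using Cons.IH[of q] ps by simp
  qed
qed (simp add: partition_of_def)

text \<open>Steps of length \<open>\<delta> / 2\<close> keep every piece strictly below \<delta>.
  Points must increase strictly, so a degenerate interval gets the one-point list.\<close>

lemma partition_of_fine: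
  assumes "s \<le> t" "0 < \<delta>"
  shows "\<exists>ps. partition_of s t ps \<and> (\<forall>(u, v)\<in>set (zip ps (tl ps)). v - u < \<delta>)"
proof -
  obtain n :: nat where "(t - s) / (\<delta> / 2) < real n" using reals_Archimedean2 by blast
  then have "t - s \<le> real n * (\<delta> / 2)" using assms by (simp add: field_simps)
  then show ?thesis
    using \<open>s \<le> t\<close>
  proof (induction n arbitrary: s)
    case 0
    then show ?case by (intro exI[of _ "[s]"]) (auto simp: partition_of_def)
  next
    case (Suc n)
    consider "s = t" | "s < t" "t - s < \<delta>" | "\<delta> / 2 < t - s"
      using Suc.prems assms by linarith
    then show ?case
    proof cases
      case 1
      then show ?thesis by (intro exI[of _ "[s]"]) (auto simp: partition_of_def)
    next
      case 2
      then show ?thesis by (intro exI[of _ "[s, t]"]) (auto simp: partition_of_def)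
    next
      case 3
      then obtain ps where ps: "partition_of (s + \<delta> / 2) t ps"
          "\<forall>(u, v)\<in>set (zip ps (tl ps)). v - u < \<delta>"
        using Suc.IH[of "s + \<delta> / 2"] Suc.prems by (auto simp: algebra_simps)
      then obtain qs where "ps = (s + \<delta> / 2) # qs"
        by (cases ps) (auto simp: partition_of_def)
      then show ?thesis
        using ps assms by (intro exI[of _ "s # ps"]) (auto simp: partition_of_def intro: less_trans[of s "s + \<delta> / 2"])
    qed
  qed
qed

text \<open>Convergence determines \<open>Lim\<close> only along a proper filter. The mesh
  conditions form a filter base by taking minima, and no member of it is empty.\<close>

lemma partitions_neq_bot:
  assumes "s \<le> t"
  shows "partitions s t \<noteq> bot"
proof
  assume "partitions s t = bot"
  then have "eventually (\<lambda>_. False) (partitions s t)" by simp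
  moreover have "eventually (\<lambda>_. False) (partitions s t) \<longleftrightarrow>
    (\<exists>\<delta>\<in>{0<..}. eventually (\<lambda>_. False)
      (principal {ps. partition_of s t ps \<and> (\<forall>(u, v)\<in>set (zip ps (tl ps)). v - u < \<delta>)}))"
    unfolding partitions_def
  proof (rule eventually_INF_base)
    fix x y :: real assume "x \<in> {0<..}" "y \<in> {0<..}"
    then show "\<exists>z\<in>{0<..}. principal {ps. partition_of s t ps \<and> (\<forall>(u, v)\<in>set (zip ps (tl ps)). v - u < z)}
      \<le> inf (principal {ps. partition_of s t ps \<and> (\<forall>(u, v)\<in>set (zip ps (tl ps)). v - u < x)})
          (principal {ps. partition_of s t ps \<and> (\<forall>(u, v)\<in>set (zip ps (tl ps)). v - u < y)})"
      by (intro bexI[of _ "min x y"]) auto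
  qed auto
  ultimately show False
    using partition_of_fine[OF assms] by (auto simp: eventually_principal)
qed

text \<open>Writing the error of a piece as its length times the power \<open>\<theta> - 1\<close>
  of its length, the lengths add up to \<open>t - s\<close> and the remaining power is at most that
  of the mesh.\<close>

lemma tendsto_partitions:
  fixes A :: "real \<Rightarrow> real \<Rightarrow> 'w::real_normed_vector"
  assumes theta: "1 < \<theta>"
    and I: "\<And>u v. \<lbrakk>s \<le> u; u \<le> v; v \<le> t\<rbrakk> \<Longrightarrow> norm (I v - I u - A u v) \<le> B * (v - u) powr \<theta>"
    and st: "s \<le> t"
  shows "((\<lambda>ps. \<Sum>(u, v)\<leftarrow>zip ps (tl ps). A u v) \<longlongrightarrow> I t - I s) (partitions s t)"
proof (rule tendstoI)
  fix e :: real assume e: "0 < e"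
  \<comment> \<open>The summand 1 keeps \<open>M\<close> positive and makes the final inequality
    strict.\<close>
  define M where "M = \<bar>B\<bar> * (t - s) + 1"
  have M: "0 < M" using st by (simp add: M_def add_nonneg_pos)
  define \<delta> where "\<delta> = (e / M) powr (1 / (\<theta> - 1))"
  have \<delta>: "0 < \<delta>" "\<delta> powr (\<theta> - 1) = e / M"
    using e M theta by (simp_all add: \<delta>_def powr_powr)
  have "dist (\<Sum>(u, v)\<leftarrow>zip ps (tl ps). A u v) (I t - I s) < e"
    if ps: "partition_of s t ps" "\<forall>(u, v)\<in>set (zip ps (tl ps)). v - u < \<delta>" for ps
  proof -
    \<comment> \<open>The estimate is proved for arbitrary lists of pieces, because the tail of the
      list of pieces no longer belongs to a partition of \<open>[s, t]\<close>.\<close>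
    have "norm ((\<Sum>(u, v)\<leftarrow>qs. A u v) - (\<Sum>(u, v)\<leftarrow>qs. I v - I u))
        \<le> \<bar>B\<bar> * (e / M) * (\<Sum>(u, v)\<leftarrow>qs. v - u)"
      if "set qs \<subseteq> set (zip ps (tl ps))" for qs
      using that
    proof (induction qs)
      case (Cons q qs)
      obtain u v where q: "q = (u, v)" by force
      have uv: "s \<le> u" "u < v" "v \<le> t" "v - u < \<delta>"
        using Cons.prems partition_of_pairs[OF ps(1), of u v] ps(2) by (auto simp: q)
      have "norm (I v - I u - A u v) \<le> B * (v - u) powr \<theta>" using I uv by simp
      also have "\<dots> \<le> \<bar>B\<bar> * (v - u) powr \<theta>" by (intro mult_right_mono) auto
      also have "(v - u) powr \<theta> = (v - u) powr (\<theta> - 1) * (v - u)"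
        using uv by (simp add: powr_diff)
      also have "\<bar>B\<bar> * \<dots> \<le> \<bar>B\<bar> * (\<delta> powr (\<theta> - 1) * (v - u))"
        using uv theta by (intro mult_left_mono mult_right_mono powr_mono2) auto
      finally have *: "norm (I v - I u - A u v) \<le> \<bar>B\<bar> * (e / M) * (v - u)"
        by (simp add: \<delta> mult.assoc)
      have "norm ((\<Sum>(u, v)\<leftarrow>q # qs. A u v) - (\<Sum>(u, v)\<leftarrow>q # qs. I v - I u))
          \<le> norm (I v - I u - A u v) + norm ((\<Sum>(u, v)\<leftarrow>qs. A u v) - (\<Sum>(u, v)\<leftarrow>qs. I v - I u))"
        unfolding q list.map sum_list.Cons prod.case by norm
      also have "\<dots> \<le> \<bar>B\<bar> * (e / M) * (v - u) + \<bar>B\<bar> * (e / M) * (\<Sum>(u, v)\<leftarrow>qs. v - u)"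
        using * Cons by (intro add_mono) auto
      finally show ?case by (simp add: q distrib_left)
    qed simp
    from this[OF order_refl]
    have "norm ((\<Sum>(u, v)\<leftarrow>zip ps (tl ps). A u v) - (I t - I s)) \<le> \<bar>B\<bar> * (e / M) * (t - s)"
      using partition_of_telescope[OF ps(1), of I] partition_of_telescope[OF ps(1), of "\<lambda>x. x"] by simp
    also have "\<dots> = (\<bar>B\<bar> * (t - s)) / M * e" by simp
    also have "\<dots> < 1 * e"
      using M e by (intro mult_strict_right_mono) (auto simp: M_def)
    finally show ?thesis by (simp add: dist_norm)
  qed
  then show "\<forall>\<^sub>F ps in partitions s t. dist (\<Sum>(u, v)\<leftarrow>zip ps (tl ps). A u v) (I t - I s) < e"
    unfolding partitions_def using \<delta>(1)
    by (intro eventually_INF1[of \<delta>]) (auto simp: eventually_principal)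
qed

section \<open>Rough integrals of controlled paths\<close>

lemma norm_blinfun_le:
  assumes "norm f \<le> a" "norm x \<le> b"
  shows "norm (blinfun_apply f x) \<le> a * b"
  using norm_blinfun[of f x] mult_mono[OF assms order_trans[OF norm_ge_zero assms(1)] norm_ge_zero]
  by linarith

lemma norm_blinfun_compose_le:
  assumes "norm f \<le> a" "norm g \<le> b"
  shows "norm (f o\<^sub>L g) \<le> a * b"
  using norm_blinfun_compose[of f g] mult_mono[OF assms order_trans[OF norm_ge_zero assms(1)] norm_ge_zero]
  by linarith

lemma norm_minus4_le:
  fixes a b c d :: "'a::real_normed_vector"
  assumes "norm a \<le> A" "norm b \<le> B" "norm c \<le> C" "norm d \<le> D"
  shows "norm (- a - b - (c + d)) \<le> A + B + (C + D)"
  using assms by norm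

text \<open>One constant \<open>K\<close> bounds all data, and \<open>1 \<le> K\<close> lets lower
  powers be absorbed into higher ones. The exponent \<open>2 * \<alpha>\<close> is written as a
  square, so that estimates become polynomial in \<open>(t - s) powr \<alpha>\<close>.\<close>

locale rough_driver =
  fixes \<alpha> T K :: real
    and tens :: "'v::banach \<Rightarrow> 'v \<Rightarrow> 't::banach"
    and X :: "real \<Rightarrow> real \<Rightarrow> 'v" and XX :: "real \<Rightarrow> real \<Rightarrow> 't"
    and Z :: "real \<Rightarrow> 'u::banach" and Z' :: "real \<Rightarrow> 'v \<Rightarrow>\<^sub>L 'u"
  assumes alpha: "1/3 < \<alpha>"
    and tens: "projective_tensor tens"
    and K: "1 \<le> K"
    and chen1: "\<And>s u t. \<lbrakk>0 \<le> s; s \<le> u; u \<le> t; t \<le> T\<rbrakk> \<Longrightarrow> X s t = X s u + X u t"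
    and chen2: "\<And>s u t. \<lbrakk>0 \<le> s; s \<le> u; u \<le> t; t \<le> T\<rbrakk> \<Longrightarrow>
      XX s t = XX s u + XX u t + tens (X s u) (X u t)"
    and X_le: "\<And>s t. \<lbrakk>0 \<le> s; s \<le> t; t \<le> T\<rbrakk> \<Longrightarrow> norm (X s t) \<le> K * (t - s) powr \<alpha>"
    and XX_le: "\<And>s t. \<lbrakk>0 \<le> s; s \<le> t; t \<le> T\<rbrakk> \<Longrightarrow> norm (XX s t) \<le> K * ((t - s) powr \<alpha>)\<^sup>2"
    and Z'_le: "\<And>t. \<lbrakk>0 \<le> t; t \<le> T\<rbrakk> \<Longrightarrow> norm (Z' t) \<le> K"
    and Z'_incr_le: "\<And>s t. \<lbrakk>0 \<le> s; s \<le> t; t \<le> T\<rbrakk> \<Longrightarrow> norm (Z' t - Z' s) \<le> K * (t - s) powr \<alpha>"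
    and Z_incr_le: "\<And>s t. \<lbrakk>0 \<le> s; s \<le> t; t \<le> T\<rbrakk> \<Longrightarrow> norm (Z t - Z s) \<le> K * (t - s) powr \<alpha>"
    and Z_rem_le: "\<And>s t. \<lbrakk>0 \<le> s; s \<le> t; t \<le> T\<rbrakk> \<Longrightarrow>
      norm (Z t - Z s - blinfun_apply (Z' s) (X s t)) \<le> K * ((t - s) powr \<alpha>)\<^sup>2"
begin

abbreviation Lam :: "('v \<Rightarrow>\<^sub>L 'u \<Rightarrow>\<^sub>L 'w::banach) \<Rightarrow> ('v \<Rightarrow>\<^sub>L 'u) \<Rightarrow> 't \<Rightarrow>\<^sub>L 'w" where
  "Lam \<equiv> blinfun_tensor tens"

definition germ :: "(real \<Rightarrow> 'u \<Rightarrow>\<^sub>L 'w::banach) \<Rightarrow> (real \<Rightarrow> 'v \<Rightarrow>\<^sub>L 'u \<Rightarrow>\<^sub>L 'w) \<Rightarrow> real \<Rightarrow> real \<Rightarrow> 'w" where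
  "germ G G' s t = blinfun_apply (G s) (Z t - Z s) + blinfun_apply (Lam (G' s) (Z' s)) (XX s t)"

definition rem :: "(real \<Rightarrow> 'e::real_normed_vector) \<Rightarrow> (real \<Rightarrow> 'v \<Rightarrow>\<^sub>L 'e) \<Rightarrow> real \<Rightarrow> real \<Rightarrow> 'e" where
  "rem Y Y' s t = Y t - Y s - blinfun_apply (Y' s) (X s t)"

text \<open>Only the seminorms are bounded: for a difference of paths with common start they control
  everything else. The left end is free because uniqueness proceeds along subintervals.\<close>

definition holder_ctrl :: "real \<Rightarrow> real \<Rightarrow> real \<Rightarrow> (real \<Rightarrow> 'e::real_normed_vector) \<Rightarrow> (real \<Rightarrow> 'v \<Rightarrow>\<^sub>L 'e) \<Rightarrow> bool" where
  "holder_ctrl c a b Y Y' \<longleftrightarrow> (\<forall>s t. a \<le> s \<and> s \<le> t \<and> t \<le> b \<longrightarrow>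
     norm (Y' t - Y' s) \<le> c * (t - s) powr \<alpha> \<and> norm (rem Y Y' s t) \<le> c * ((t - s) powr \<alpha>)\<^sup>2)"

definition ctrl :: "real \<Rightarrow> real \<Rightarrow> real \<Rightarrow> (real \<Rightarrow> 'e::real_normed_vector) \<Rightarrow> (real \<Rightarrow> 'v \<Rightarrow>\<^sub>L 'e) \<Rightarrow> bool" where
  "ctrl c a b Y Y' \<longleftrightarrow> holder_ctrl c a b Y Y' \<and> (\<forall>t. a \<le> t \<and> t \<le> b \<longrightarrow> norm (Y' t) \<le> c)"

lemma holder_ctrlD:
  assumes "holder_ctrl c a b Y Y'" "a \<le> s" "s \<le> t" "t \<le> b"
  shows "norm (Y' t - Y' s) \<le> c * (t - s) powr \<alpha>" "norm (rem Y Y' s t) \<le> c * ((t - s) powr \<alpha>)\<^sup>2"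
  using assms unfolding holder_ctrl_def by auto

lemma ctrlD:
  assumes "ctrl c a b Y Y'" "a \<le> t" "t \<le> b"
  shows "norm (Y' t) \<le> c" "holder_ctrl c a b Y Y'"
  using assms unfolding ctrl_def by auto

lemma norm_Lam_le:
  fixes g :: "'v \<Rightarrow>\<^sub>L 'u \<Rightarrow>\<^sub>L 'w::banach"
  assumes "norm g \<le> a" "norm z \<le> b" "norm x \<le> c"
  shows "norm (blinfun_apply (Lam g z) x) \<le> a * b * c"
proof (rule norm_blinfun_le[OF _ assms(3)])
  have "0 \<le> a" using assms(1) norm_ge_zero order_trans by blast
  then show "norm (Lam g z) \<le> a * b"
    using norm_blinfun_tensor_le[OF tens, of g z] mult_mono[OF assms(1,2)] by fastforce
qed

lemma germ_diff:
  "germ (\<lambda>r. G r - H r) (\<lambda>r. G' r - H' r) s t = germ G G' s t - germ H H' s t"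
  by (simp add: germ_def blinfun.bilinear_simps
      bounded_bilinear.diff_left[OF bounded_bilinear_blinfun_tensor[OF tens]])

lemma powr_three_alpha:
  assumes "0 \<le> r"
  shows "r powr (3 * \<alpha>) = (r powr \<alpha>) ^ 3"
proof (cases "r = 0")
  case False
  then have "(r powr \<alpha>) ^ 3 = (r powr \<alpha>) powr 3"
    using assms powr_realpow[of "r powr \<alpha>" 3] by simp
  then show ?thesis by (simp add: powr_powr mult.commute)
qed simp

lemma powr_alpha_mono:
  assumes "a \<le> s" "s \<le> t" "t \<le> b"
  shows "(t - s) powr \<alpha> \<le> (b - a) powr \<alpha>"
  using assms alpha by (intro powr_mono2) auto

text \<open>Chen's relation produces \<open>G' s\<close> on \<open>X s u\<close> paired with
  \<open>Z' s\<close> on \<open>X u t\<close>, which cancels the leading part of the increment of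
  \<open>G\<close> acting on \<open>Z t - Z u\<close>. What is left are products of one factor of
  order \<alpha> and one of order \<open>2 * \<alpha>\<close>.\<close>

lemma germ_defect_bound:
  assumes ctrl: "ctrl g a b G G'" and ab: "0 \<le> a" "b \<le> T"
    and sut: "a \<le> s" "s \<le> u" "u \<le> t" "t \<le> b"
  shows "norm (germ G G' s t - germ G G' s u - germ G G' u t) \<le> 5 * K ^ 3 * g * (t - s) powr (3 * \<alpha>)"
proof -
  define p where "p = (t - s) powr \<alpha>"
  have p: "0 \<le> p" by (simp add: p_def)
  have psu: "(u - s) powr \<alpha> \<le> p" and put: "(t - u) powr \<alpha> \<le> p"
    unfolding p_def using sut by (auto intro: powr_alpha_mono)
  have psu2: "((u - s) powr \<alpha>)\<^sup>2 \<le> p\<^sup>2" and put2: "((t - u) powr \<alpha>)\<^sup>2 \<le> p\<^sup>2"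
    using psu put by (auto intro: power_mono)
  have g: "0 \<le> g" using ctrlD(1)[OF ctrl, of s] sut norm_ge_zero[of "G' s"] by linarith
  have st: "0 \<le> s" "0 \<le> u" "s \<le> t" "t \<le> T" "u \<le> T" "s \<le> T" using ab sut by auto
  have b: "norm (X s u) \<le> K * p" "norm (X u t) \<le> K * p" "norm (Z t - Z u) \<le> K * p"
    "norm (Z' u - Z' s) \<le> K * p" "norm (G' u - G' s) \<le> g * p"
    "norm (XX u t) \<le> K * p\<^sup>2" "norm (Z t - Z u - blinfun_apply (Z' u) (X u t)) \<le> K * p\<^sup>2"
    "norm (rem G G' s u) \<le> g * p\<^sup>2"
    using st sut K g psu put psu2 put2 holder_ctrlD[OF ctrlD(2)[OF ctrl], of s s u]
    by (auto intro: order_trans[OF X_le] order_trans[OF Z_incr_le] order_trans[OF Z'_incr_le]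
        order_trans[OF XX_le] order_trans[OF Z_rem_le] mult_left_mono elim!: order_trans)
  have b': "norm (Z' u) \<le> K" "norm (G' s) \<le> g" "norm (Z' s) \<le> K"
    using Z'_le st ctrlD(1)[OF ctrl] sut by auto
  \<comment> \<open>The increment of \<open>Z\<close> over \<open>[u, t]\<close> minus its
    prediction by the derivative at \<open>s\<close>. Moving the base point from \<open>u\<close> to
    \<open>s\<close> costs the second summand, again of order \<open>2 * \<alpha>\<close>.\<close>
  define N where "N = (Z t - Z u - blinfun_apply (Z' u) (X u t)) + blinfun_apply (Z' u - Z' s) (X u t)"
  have N: "norm N \<le> K * p\<^sup>2 + (K * p) * (K * p)"
    unfolding N_def by (intro norm_triangle_le add_mono b norm_blinfun_le)
  have X_st: "XX s t = XX s u + XX u t + tens (X s u) (X u t)"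
    using chen2[of s u t] st sut by simp
  note bil = bounded_bilinear_blinfun_tensor[OF tens]
  have "germ G G' s t - germ G G' s u - germ G G' u t =
      - (blinfun_apply (rem G G' s u) (Z t - Z u)) - blinfun_apply (blinfun_apply (G' s) (X s u)) N
      - (blinfun_apply (Lam (G' u - G' s) (Z' u)) (XX u t) + blinfun_apply (Lam (G' s) (Z' u - Z' s)) (XX u t))"
    by (simp add: germ_def rem_def N_def X_st blinfun.bilinear_simps blinfun_tensor_apply[OF tens]
        bounded_bilinear.diff_left[OF bil] bounded_bilinear.diff_right[OF bil] algebra_simps)
  also have "norm \<dots> \<le> (g * p\<^sup>2) * (K * p) + (g * (K * p)) * (K * p\<^sup>2 + (K * p) * (K * p))
      + ((g * p) * K * (K * p\<^sup>2) + g * (K * p) * (K * p\<^sup>2))"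
    by (rule norm_minus4_le norm_blinfun_le norm_Lam_le b b' N)+
  also have "\<dots> = (K + 3 * K\<^sup>2 + K ^ 3) * (g * p ^ 3)"
    by (simp add: algebra_simps power2_eq_square power3_eq_cube)
  also have "\<dots> \<le> (5 * K ^ 3) * (g * p ^ 3)"
  proof (rule mult_right_mono)
    show "K + 3 * K\<^sup>2 + K ^ 3 \<le> 5 * K ^ 3"
      using power_increasing[of 1 3 K] power_increasing[of 2 3 K] K by simp
  qed (use g p in simp)
  finally show ?thesis using st by (simp add: p_def powr_three_alpha mult.assoc)
qed

definition S :: real where "S = 5 * K ^ 3 * sewing_const (3 * \<alpha>)"

lemma S_pos: "0 < S"
  using K sewing_const(1)[of "3 * \<alpha>"] alpha by (simp add: S_def)

lemma ctrl_nonneg: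
  assumes "ctrl g a b G G'" "a \<le> b"
  shows "0 \<le> g"
  using ctrlD(1)[OF assms(1), of a] assms(2) norm_ge_zero[of "G' a"] by linarith

lemma sewing_germ_germ:
  assumes "ctrl g a b G G'" "0 \<le> a" "a \<le> b" "b \<le> T"
  shows "sewing_germ (germ G G') (3 * \<alpha>) (5 * K ^ 3 * g) a b"
  using alpha germ_defect_bound[OF assms(1,2,4)] ctrl_nonneg[OF assms(1,3)] K
  by unfold_locales auto

text \<open>The constant \<open>B\<close> may come from anywhere, for instance from the separate
  norms of two solutions. \<open>sewing_bound\<close> trades it for one proportional to
  \<open>g\<close>, and this proportionality is the source of the contraction.\<close>

lemma germ_sewing_bound:
  assumes ctrl: "ctrl g a b G G'" "0 \<le> a" "b \<le> T"
    and B: "\<And>s t. \<lbrakk>a \<le> s; s \<le> t; t \<le> b\<rbrakk> \<Longrightarrow> norm (I t - I s - germ G G' s t) \<le> B * (t - s) powr (3 * \<alpha>)"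
    and st: "a \<le> s" "s \<le> t" "t \<le> b"
  shows "norm (I t - I s - germ G G' s t) \<le> S * g * ((t - s) powr \<alpha>) ^ 3"
proof -
  interpret sewing_germ "germ G G'" "3 * \<alpha>" "5 * K ^ 3 * g" a b
    by (rule sewing_germ_germ[OF ctrl(1)]) (use ctrl st in auto)
  have "sewing_const (3 * \<alpha>) * (5 * K ^ 3 * g) = S * g"
    by (simp add: S_def)
  then show ?thesis
    using sewing_bound[of I B, OF B st] st by (simp only: powr_three_alpha diff_ge_0_iff_ge)
qed

lemma rough_integral_eqI:
  assumes I: "\<And>s t. \<lbrakk>0 \<le> s; s \<le> t; t \<le> b\<rbrakk> \<Longrightarrow> norm (I t - I s - germ G G' s t) \<le> B * (t - s) powr (3 * \<alpha>)"
    and st: "0 \<le> s" "s \<le> t" "t \<le> b"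
  shows "rough_integral tens XX G G' Z Z' s t = I t - I s"
proof -
  have "((\<lambda>ps. \<Sum>(u, v)\<leftarrow>zip ps (tl ps). germ G G' u v) \<longlongrightarrow> I t - I s) (partitions s t)"
    using alpha st by (intro tendsto_partitions[where \<theta> = "3 * \<alpha>" and B = B] I) auto
  from tendsto_Lim[OF partitions_neq_bot[OF st(2)] this] show ?thesis
    by (simp add: rough_integral_def germ_def blinfun_tensor_def)
qed

text \<open>Both integrals from 0 are increments of one sewn path, so their difference inherits its
  estimate; this includes additivity of the integral.\<close>

lemma rough_integral_bound:
  assumes ctrl: "ctrl g 0 b G G'" "b \<le> T" and st: "0 \<le> s" "s \<le> t" "t \<le> b"
  shows "norm (rough_integral tens XX G G' Z Z' 0 t - rough_integral tens XX G G' Z Z' 0 s - germ G G' s t)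
    \<le> S * g * ((t - s) powr \<alpha>) ^ 3"
proof -
  interpret sewing_germ "germ G G'" "3 * \<alpha>" "5 * K ^ 3 * g" 0 b
    by (rule sewing_germ_germ[OF ctrl(1)]) (use ctrl st in auto)
  obtain I where I: "\<And>s t. \<lbrakk>0 \<le> s; s \<le> t; t \<le> b\<rbrakk> \<Longrightarrow>
      norm (I t - I s - germ G G' s t) \<le> sewing_const (3 * \<alpha>) * (5 * K ^ 3 * g) * (t - s) powr (3 * \<alpha>)"
    using sewing_exists st by fastforce
  have "rough_integral tens XX G G' Z Z' 0 r = I r - I 0" if "0 \<le> r" "r \<le> b" for r
    using rough_integral_eqI[OF I, where s = 0 and t = r] that by simp
  then show ?thesis
    using germ_sewing_bound[OF ctrl(1) _ ctrl(2) I st] st by simp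
qed

lemma rough_integral_refl:
  assumes "ctrl g 0 b G G'" "b \<le> T" "0 \<le> b"
  shows "rough_integral tens XX G G' Z Z' 0 0 = 0"
proof -
  have "norm (rough_integral tens XX G G' Z Z' 0 t - rough_integral tens XX G G' Z Z' 0 s - germ G G' s t)
    \<le> S * g * (t - s) powr (3 * \<alpha>)" if "0 \<le> s" "s \<le> t" "t \<le> b" for s t
    using rough_integral_bound[OF assms(1,2) that] that by (simp add: powr_three_alpha)
  from rough_integral_eqI[OF this, of 0 0] assms show ?thesis by simp
qed

end

section \<open>Composition with a smooth field\<close>

text \<open>The derivatives of \<open>F\<close> are parameters with their defining property. The
  bounded third derivative appears as a Lipschitz bound on \<open>D2F\<close>.\<close>

locale rough_equation = rough_driver \<alpha> T K tens X XX Z Z'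
  for \<alpha> T K :: real
    and tens :: "'v::banach \<Rightarrow> 'v \<Rightarrow> 't::banach"
    and X :: "real \<Rightarrow> real \<Rightarrow> 'v" and XX :: "real \<Rightarrow> real \<Rightarrow> 't"
    and Z :: "real \<Rightarrow> 'u::banach" and Z' :: "real \<Rightarrow> 'v \<Rightarrow>\<^sub>L 'u" +
  fixes F :: "'w::banach \<Rightarrow> 'u \<Rightarrow>\<^sub>L 'w"
    and DF :: "'w \<Rightarrow> 'w \<Rightarrow>\<^sub>L 'u \<Rightarrow>\<^sub>L 'w"
    and D2F :: "'w \<Rightarrow> 'w \<Rightarrow>\<^sub>L 'w \<Rightarrow>\<^sub>L 'u \<Rightarrow>\<^sub>L 'w"
  assumes F_der: "\<And>x. (F has_derivative blinfun_apply (DF x)) (at x)"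
    and DF_der: "\<And>x. (DF has_derivative blinfun_apply (D2F x)) (at x)"
    and F_le: "\<And>x. norm (F x) \<le> K" and DF_le: "\<And>x. norm (DF x) \<le> K" and D2F_le: "\<And>x. norm (D2F x) \<le> K"
    and D2F_lip: "\<And>x y. norm (D2F x - D2F y) \<le> K * norm (x - y)"
begin

text \<open>Kept apart from \<open>ctrl\<close>, since the Hoelder constant of the path itself can
  be much smaller than that of its controlled structure.\<close>

definition incr :: "real \<Rightarrow> real \<Rightarrow> real \<Rightarrow> (real \<Rightarrow> 'e::real_normed_vector) \<Rightarrow> bool" where
  "incr c a b Y \<longleftrightarrow> (\<forall>s t. a \<le> s \<and> s \<le> t \<and> t \<le> b \<longrightarrow> norm (Y t - Y s) \<le> c * (t - s) powr \<alpha>)"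

lemma incrD: "incr c a b Y \<Longrightarrow> a \<le> s \<Longrightarrow> s \<le> t \<Longrightarrow> t \<le> b \<Longrightarrow> norm (Y t - Y s) \<le> c * (t - s) powr \<alpha>"
  unfolding incr_def by auto

abbreviation FD :: "(real \<Rightarrow> 'w) \<Rightarrow> (real \<Rightarrow> 'v \<Rightarrow>\<^sub>L 'w) \<Rightarrow> real \<Rightarrow> 'v \<Rightarrow>\<^sub>L 'u \<Rightarrow>\<^sub>L 'w" where
  "FD Y Y' \<equiv> \<lambda>r. DF (Y r) o\<^sub>L Y' r"

lemma F_lip: "norm (F x - F y) \<le> K * norm (x - y)"
  by (rule blinfun_derivative_imp_lipschitz[OF F_der DF_le])

lemma DF_lip: "norm (DF x - DF y) \<le> K * norm (x - y)"
  by (rule blinfun_derivative_imp_lipschitz[OF DF_der D2F_le])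

lemma F_lip_le: "norm (x - y) \<le> c \<Longrightarrow> norm (F x - F y) \<le> K * c"
  using F_lip[of x y] mult_left_mono[of "norm (x - y)" c K] K by linarith

lemma DF_lip_le: "norm (x - y) \<le> c \<Longrightarrow> norm (DF x - DF y) \<le> K * c"
  using DF_lip[of x y] mult_left_mono[of "norm (x - y)" c K] K by linarith

lemma taylor_F_le:
  assumes "norm (y - x) \<le> c"
  shows "norm (F y - F x - blinfun_apply (DF x) (y - x)) \<le> K * c * c"
proof -
  \<comment> \<open>The second path is taken constant, so that its Taylor remainder
    vanishes.\<close>
  have "norm (F y - F x - blinfun_apply (DF x) (y - x)) \<le> K * norm (y - x) * norm (y - x)"
    using taylor_difference_bound[OF F_der DF_der D2F_le D2F_lip, of y x x x] by (simp add: blinfun.zero_right)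
  also have "\<dots> \<le> K * c * c"
    using assms K order_trans[OF norm_ge_zero assms] by (intro mult_mono) auto
  finally show ?thesis .
qed

lemma norm_comp_increment_le:
  assumes "norm (g2 - g1) \<le> a" "norm h2 \<le> b" "norm g1 \<le> c" "norm (h2 - h1) \<le> d"
  shows "norm ((g2 o\<^sub>L h2) - (g1 o\<^sub>L h1)) \<le> a * b + c * d"
proof -
  have "(g2 o\<^sub>L h2) - (g1 o\<^sub>L h1) = ((g2 - g1) o\<^sub>L h2) + (g1 o\<^sub>L (h2 - h1))"
    by (rule blinfun_eqI) (simp add: blinfun.bilinear_simps)
  then show ?thesis
    using assms by (auto intro!: norm_triangle_le add_mono norm_blinfun_compose_le)
qed

lemma ctrl_compose:
  assumes Y: "ctrl M a b Y Y'" "incr M a b Y" and M: "K \<le> M"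
  shows "ctrl (2 * M ^ 3) a b (\<lambda>r. F (Y r)) (FD Y Y')"
proof -
  have M1: "1 \<le> M" using K M by linarith
  have pw: "M\<^sup>2 \<le> M ^ 3" using power_increasing[of 2 3 M] M1 by simp
  have DFM: "norm (DF x) \<le> M" for x using DF_le[of x] M by linarith
  show ?thesis
    unfolding ctrl_def holder_ctrl_def
  proof (intro conjI allI impI)
    fix t assume "a \<le> t \<and> t \<le> b"
    then have "norm (FD Y Y' t) \<le> M * M"
      using ctrlD(1)[OF Y(1)] by (intro norm_blinfun_compose_le DFM) auto
    also have "\<dots> \<le> 2 * M ^ 3" using pw M1 zero_le_power[of M 3] unfolding power2_eq_square by linarith
    finally show "norm (FD Y Y' t) \<le> 2 * M ^ 3" .
  next
    fix s t assume "a \<le> s \<and> s \<le> t \<and> t \<le> b"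
    then have st: "a \<le> s" "s \<le> t" "t \<le> b" "s \<le> b" "a \<le> t" by auto
    define p where "p = (t - s) powr \<alpha>"
    have p: "0 \<le> p" by (simp add: p_def)
    note b = incrD[OF Y(2) st(1-3), folded p_def] ctrlD(1)[OF Y(1) st(1,4)] ctrlD(1)[OF Y(1) st(5,3)]
      holder_ctrlD[OF ctrlD(2)[OF Y(1) st(1,4)] st(1-3), folded p_def]
    have "norm (FD Y Y' t - FD Y Y' s) \<le> (K * (M * p)) * M + M * (M * p)"
      by (rule norm_comp_increment_le[OF DF_lip_le[OF b(1)] b(3) DFM b(4)])
    also have "\<dots> \<le> (M * (M * p)) * M + M * (M * p)"
      using M M1 p by (intro add_mono mult_right_mono) auto
    also have "\<dots> = (M ^ 3 + M\<^sup>2) * p"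
      by (simp add: algebra_simps power2_eq_square power3_eq_cube)
    also have "\<dots> \<le> (2 * M ^ 3) * p"
      using pw p by (intro mult_right_mono) auto
    finally show "norm (FD Y Y' t - FD Y Y' s) \<le> 2 * M ^ 3 * (t - s) powr \<alpha>" by (simp add: p_def)
    have "rem (\<lambda>r. F (Y r)) (FD Y Y') s t =
        (F (Y t) - F (Y s) - blinfun_apply (DF (Y s)) (Y t - Y s)) + blinfun_apply (DF (Y s)) (rem Y Y' s t)"
      by (simp add: rem_def blinfun.bilinear_simps)
    also have "norm \<dots> \<le> K * (M * p) * (M * p) + M * (M * p\<^sup>2)"
      by (rule norm_triangle_le) (rule add_mono taylor_F_le norm_blinfun_le b DFM)+
    also have "\<dots> \<le> M * (M * p) * (M * p) + M * (M * p\<^sup>2)"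
      using M M1 p by (intro add_mono mult_right_mono) auto
    also have "\<dots> = (M ^ 3 + M\<^sup>2) * p\<^sup>2"
      by (simp add: algebra_simps power2_eq_square power3_eq_cube)
    also have "\<dots> \<le> (2 * M ^ 3) * p\<^sup>2"
      using pw p by (intro mult_right_mono) auto
    finally show "norm (rem (\<lambda>r. F (Y r)) (FD Y Y') s t) \<le> 2 * M ^ 3 * ((t - s) powr \<alpha>)\<^sup>2"
      by (simp add: p_def)
  qed
qed

text \<open>Two sizes are tracked: \<open>c\<close> for the seminorms of the difference and the
  smaller \<open>e\<close> for its values and increments. The bounds that enter an integral directly
  are in terms of \<open>e\<close>; the \<open>ctrl\<close> bound may be in terms of
  \<open>c\<close>, because it is only used in the sewing error.\<close>

lemma ctrl_compose_diff:
  assumes Y: "ctrl M a b Y Y'" "incr M a b Y" and V: "ctrl M a b V V'" "incr M a b V"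
    and M: "K \<le> M" and e: "0 \<le> e" "e \<le> c"
    and De: "\<And>t. a \<le> t \<Longrightarrow> t \<le> b \<Longrightarrow> norm (Y t - V t) \<le> e"
    and De': "\<And>t. a \<le> t \<Longrightarrow> t \<le> b \<Longrightarrow> norm (Y' t - V' t) \<le> e"
    and Di: "incr e a b (\<lambda>r. Y r - V r)"
    and Dh: "holder_ctrl c a b (\<lambda>r. Y r - V r) (\<lambda>r. Y' r - V' r)"
  shows "ctrl (6 * M ^ 3 * c) a b (\<lambda>r. F (Y r) - F (V r)) (\<lambda>r. FD Y Y' r - FD V V' r)"
    and "\<And>t. a \<le> t \<Longrightarrow> t \<le> b \<Longrightarrow> norm (F (Y t) - F (V t)) \<le> M * e"
    and "\<And>t. a \<le> t \<Longrightarrow> t \<le> b \<Longrightarrow> norm (FD Y Y' t - FD V V' t) \<le> 2 * M\<^sup>2 * e"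
    and "incr (3 * M\<^sup>2 * e) a b (\<lambda>r. F (Y r) - F (V r))"
proof -
  have M1: "1 \<le> M" using K M by linarith
  have c: "0 \<le> c" using e by linarith
  have pw: "M \<le> M\<^sup>2" "M\<^sup>2 \<le> M ^ 3" "M \<le> M ^ 3"
    using power_increasing[of 1 2 M] power_increasing[of 2 3 M] power_increasing[of 1 3 M] M1 by simp_all
  have FM: "norm (DF x) \<le> M" "norm (D2F x) \<le> M" for x
    using DF_le[of x] D2F_le[of x] M by linarith+
  have "K * norm (x - y) \<le> M * norm (x - y)" for x y :: 'w
    using M by (intro mult_right_mono) auto
  then have lip: "norm (F x - F y) \<le> M * norm (x - y)" "norm (DF x - DF y) \<le> M * norm (x - y)"
    "norm (D2F x - D2F y) \<le> M * norm (x - y)" for x y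
    using F_lip[of x y] DF_lip[of x y] D2F_lip[of x y] by (meson order_trans)+
  have lip_le: "norm (F x - F y) \<le> M * r" "norm (DF x - DF y) \<le> M * r" if "norm (x - y) \<le> r" for x y r
    using lip(1,2)[of x y] mult_left_mono[OF that, of M] M1 by linarith+
  show FYV: "norm (F (Y t) - F (V t)) \<le> M * e" if "a \<le> t" "t \<le> b" for t
    using De that by (intro lip_le)
  have G': "norm (FD Y Y' t - FD V V' t) \<le> 2 * M\<^sup>2 * e" if t: "a \<le> t" "t \<le> b" for t
  proof -
    have "norm (FD Y Y' t - FD V V' t) \<le> (M * e) * M + M * e"
      using De[OF t] De'[OF t] ctrlD(1)[OF Y(1) t]
      by (intro norm_comp_increment_le lip_le FM)
    also have "\<dots> = (M\<^sup>2 + M) * e" by (simp add: algebra_simps power2_eq_square)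
    also have "\<dots> \<le> (2 * M\<^sup>2) * e" using pw e by (intro mult_right_mono) auto
    finally show ?thesis .
  qed
  then show "\<And>t. a \<le> t \<Longrightarrow> t \<le> b \<Longrightarrow> norm (FD Y Y' t - FD V V' t) \<le> 2 * M\<^sup>2 * e" .
  \<comment> \<open>Stated for a general \<open>f\<close>, as it serves both \<open>F\<close> and
    \<open>DF\<close>.\<close>
  have four: "norm (f y2 - f v2 - (f y1 - f v1)) \<le> 3 * M\<^sup>2 * e * p"
    if f: "\<And>x. (f has_derivative blinfun_apply (f' x)) (at x)" "\<And>x. norm (f' x) \<le> M"
        "\<And>x y. norm (f' x - f' y) \<le> M * norm (x - y)"
      and pts: "norm (y2 - v2 - (y1 - v1)) \<le> e * p" "norm (y1 - v1) \<le> e"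
        "norm (y2 - y1) \<le> M * p" "norm (v2 - v1) \<le> M * p" and p: "0 \<le> p"
    for f :: "'w \<Rightarrow> 'z::real_normed_vector" and f' y1 y2 v1 v2 p
  proof -
    have "norm (f y2 - f v2 - (f y1 - f v1))
        \<le> M * norm (y2 - v2 - (y1 - v1)) + M * norm (y1 - v1) * (norm (y2 - y1) + norm (v2 - v1))"
      by (rule four_point_bound[OF f])
    also have "\<dots> \<le> M * (e * p) + M * e * (M * p + M * p)"
      using pts M1 e p by (intro add_mono mult_mono) auto
    also have "\<dots> = (M + 2 * M\<^sup>2) * (e * p)" by (simp add: algebra_simps power2_eq_square)
    also have "\<dots> \<le> (3 * M\<^sup>2) * (e * p)" using pw e p by (intro mult_right_mono) auto
    finally show ?thesis by simp
  qed
  show "incr (3 * M\<^sup>2 * e) a b (\<lambda>r. F (Y r) - F (V r))"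
    unfolding incr_def
  proof (intro allI impI)
    fix s t assume st: "a \<le> s \<and> s \<le> t \<and> t \<le> b"
    show "norm (F (Y t) - F (V t) - (F (Y s) - F (V s))) \<le> 3 * M\<^sup>2 * e * (t - s) powr \<alpha>"
      by (rule four[OF F_der FM(1) lip(2)]) (use st De incrD[OF Di] incrD[OF Y(2)] incrD[OF V(2)] in auto)
  qed
  show "ctrl (6 * M ^ 3 * c) a b (\<lambda>r. F (Y r) - F (V r)) (\<lambda>r. FD Y Y' r - FD V V' r)"
    unfolding ctrl_def holder_ctrl_def
  proof (intro conjI allI impI)
    fix t assume "a \<le> t \<and> t \<le> b"
    then have "norm (FD Y Y' t - FD V V' t) \<le> 2 * M\<^sup>2 * e" using G' by auto
    also have "\<dots> \<le> 6 * M ^ 3 * c" using pw e M1 by (intro mult_mono) auto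
    finally show "norm (FD Y Y' t - FD V V' t) \<le> 6 * M ^ 3 * c" .
  next
    fix s t assume "a \<le> s \<and> s \<le> t \<and> t \<le> b"
    then have st: "a \<le> s" "s \<le> t" "t \<le> b" "s \<le> b" "a \<le> t" by auto
    define p where "p = (t - s) powr \<alpha>"
    have p: "0 \<le> p" by (simp add: p_def)
    note bY = incrD[OF Y(2) st(1-3), folded p_def] ctrlD(1)[OF Y(1) st(1,4)] ctrlD(1)[OF Y(1) st(5,3)]
      holder_ctrlD[OF ctrlD(2)[OF Y(1) st(1,4)] st(1-3), folded p_def]
    note bV = incrD[OF V(2) st(1-3), folded p_def]
    note bD = incrD[OF Di st(1-3), folded p_def] holder_ctrlD[OF Dh st(1-3), folded p_def]
      De[OF st(1,4)] De'[OF st(5,3)]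
    \<comment> \<open>The product rule for differences: the change of \<open>DF\<close> acts on
      \<open>Y'\<close>, and \<open>DF\<close> along \<open>V\<close> acts on the change of the
      derivative.\<close>
    define W where "W = (\<lambda>r. DF (Y r) - DF (V r))"
    have W_s: "norm (W s) \<le> M * e" unfolding W_def by (rule lip_le(2)[OF bD(4)])
    have W_st: "norm (W t - W s) \<le> 3 * M\<^sup>2 * e * p"
      unfolding W_def by (rule four[OF DF_der FM(2) lip(3) bD(1,4) bY(1) bV p])
    have V_st: "norm (DF (V t) - DF (V s)) \<le> M * (M * p)" by (rule lip_le(2)[OF bV])
    have split: "FD Y Y' r - FD V V' r = (W r o\<^sub>L Y' r) + (DF (V r) o\<^sub>L (Y' r - V' r))" for r
      by (rule blinfun_eqI) (simp add: W_def blinfun.bilinear_simps)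
    have "FD Y Y' t - FD V V' t - (FD Y Y' s - FD V V' s) = ((W t o\<^sub>L Y' t) - (W s o\<^sub>L Y' s))
        + ((DF (V t) o\<^sub>L (Y' t - V' t)) - (DF (V s) o\<^sub>L (Y' s - V' s)))"
      unfolding split by simp
    also have "norm \<dots> \<le> (3 * M\<^sup>2 * e * p * M + M * e * (M * p)) + (M * (M * p) * e + M * (c * p))"
      by (intro norm_triangle_le add_mono norm_comp_increment_le W_s W_st V_st bY bD FM)
    also have "\<dots> = (3 * M ^ 3 + 2 * M\<^sup>2) * (e * p) + M * (c * p)"
      by (simp add: algebra_simps power2_eq_square power3_eq_cube)
    also have "\<dots> \<le> (5 * M ^ 3) * (c * p) + M ^ 3 * (c * p)"
      using pw p e c M1 by (intro add_mono mult_mono) auto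
    finally show "norm (FD Y Y' t - FD V V' t - (FD Y Y' s - FD V V' s)) \<le> 6 * M ^ 3 * c * (t - s) powr \<alpha>"
      by (simp add: p_def algebra_simps)
    \<comment> \<open>Subtracting the difference of the Taylor remainders leaves only controlled
      remainders: \<open>W s\<close> on that of \<open>Y\<close>, and \<open>DF (V s)\<close> on
      that of \<open>Y - V\<close>.\<close>
    define \<T> where "\<T> = (F (Y t) - F (Y s) - blinfun_apply (DF (Y s)) (Y t - Y s)
        - (F (V t) - F (V s) - blinfun_apply (DF (V s)) (V t - V s)))"
    have eq: "Y t - V t - (Y s - V s) = (Y t - V t) - (Y s - V s)" by simp
    have "norm \<T> \<le> (M * norm (Y t - V t - (Y s - V s)) + M * norm (Y s - V s) * (norm (Y t - Y s) + norm (V t - V s)))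
        * norm (Y t - Y s) + M * norm (V t - V s) * norm (Y t - V t - (Y s - V s))"
      unfolding \<T>_def by (rule taylor_difference_bound[OF F_der DF_der FM(2) lip(3)])
    also have "\<dots> \<le> (M * (e * p) + M * e * (M * p + M * p)) * (M * p) + M * (M * p) * (e * p)"
      using bD bY(1) bV M1 e p by (intro add_mono mult_mono) auto
    also have "\<dots> = (2 * M ^ 3 + 2 * M\<^sup>2) * (e * p\<^sup>2)"
      by (simp add: algebra_simps power2_eq_square power3_eq_cube)
    finally have \<T>: "norm \<T> \<le> (2 * M ^ 3 + 2 * M\<^sup>2) * (e * p\<^sup>2)" .
    have "rem (\<lambda>r. F (Y r) - F (V r)) (\<lambda>r. FD Y Y' r - FD V V' r) s t
        = \<T> + blinfun_apply (W s) (rem Y Y' s t)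
          + blinfun_apply (DF (V s)) (rem (\<lambda>r. Y r - V r) (\<lambda>r. Y' r - V' r) s t)"
      by (simp add: rem_def W_def \<T>_def blinfun.bilinear_simps)
    also have "norm \<dots> \<le> (2 * M ^ 3 + 2 * M\<^sup>2) * (e * p\<^sup>2) + M * e * (M * p\<^sup>2) + M * (c * p\<^sup>2)"
      by (intro norm_add3_le \<T> norm_blinfun_le W_s bY bD FM)
    also have "\<dots> = (2 * M ^ 3 + 3 * M\<^sup>2) * (e * p\<^sup>2) + M * (c * p\<^sup>2)"
      by (simp add: algebra_simps power2_eq_square)
    also have "\<dots> \<le> (5 * M ^ 3) * (c * p\<^sup>2) + M ^ 3 * (c * p\<^sup>2)"
      using pw p e c M1 by (intro add_mono mult_mono) auto
    finally show "norm (rem (\<lambda>r. F (Y r) - F (V r)) (\<lambda>r. FD Y Y' r - FD V V' r) s t)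
        \<le> 6 * M ^ 3 * c * ((t - s) powr \<alpha>)\<^sup>2"
      by (simp add: p_def algebra_simps)
  qed
qed

end

section \<open>Contraction and uniqueness\<close>

lemma geometric_half: "c * (1 / 2) ^ n = c / (2::real) ^ n"
  by (simp only: power_divide power_one times_divide_eq_right mult_1_right)

lemma convergent_geometric_increments:
  fixes f :: "nat \<Rightarrow> 'a::banach"
  assumes "\<And>n. norm (f (Suc n) - f n) \<le> c / 2 ^ n"
  shows "convergent f"
proof -
  have "summable (\<lambda>n. c * (1 / 2) ^ n)"
    by (intro summable_mult summable_geometric) auto
  then have "summable (\<lambda>n. f (Suc n) - f n)"
    by (rule summable_comparison_test') (simp only: geometric_half assms)
  then have "convergent (\<lambda>n. \<Sum>i<n. f (Suc i) - f i)"
    by (simp add: summable_iff_convergent)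
  then have "convergent (\<lambda>n. f n - f 0)"
    by (subst (asm) sum_lessThan_telescope)
  then show ?thesis using convergent_add[OF _ convergent_const[of "f 0"]] by fastforce
qed

lemma eq_zero_if_norm_le_geometric:
  fixes x :: "'a::real_normed_vector"
  assumes "\<And>n. norm x \<le> c / 2 ^ n"
  shows "x = 0"
proof -
  have "(\<lambda>n. c * (1 / 2) ^ n) \<longlonglongrightarrow> c * 0"
    by (intro tendsto_intros LIMSEQ_power_zero) auto
  then have "norm x \<le> c * 0"
    by (rule LIMSEQ_le_const) (simp only: geometric_half assms, blast)
  then show ?thesis by simp
qed

context rough_equation
begin

lemma holder_ctrl_cong:
  assumes "holder_ctrl c a b D D'" "\<And>t. a \<le> t \<Longrightarrow> t \<le> b \<Longrightarrow> D t = E t \<and> D' t = E' t"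
  shows "holder_ctrl c a b E E'"
  unfolding holder_ctrl_def
proof (intro allI impI)
  fix s t assume "a \<le> s \<and> s \<le> t \<and> t \<le> b"
  then have "a \<le> s" "s \<le> t" "t \<le> b" "s \<le> b" "a \<le> t" by auto
  then show "norm (E' t - E' s) \<le> c * (t - s) powr \<alpha> \<and> norm (rem E E' s t) \<le> c * ((t - s) powr \<alpha>)\<^sup>2"
    using holder_ctrlD[OF assms(1), of s t] assms(2)[of s] assms(2)[of t] by (simp add: rem_def)
qed

lemma holder_ctrl_diff:
  assumes Y: "holder_ctrl c a b Y Y'" and V: "holder_ctrl c a b V V'"
  shows "holder_ctrl (2 * c) a b (\<lambda>r. Y r - V r) (\<lambda>r. Y' r - V' r)"
  unfolding holder_ctrl_def
proof (intro allI impI)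
  fix s t assume "a \<le> s \<and> s \<le> t \<and> t \<le> b"
  then have st: "a \<le> s" "s \<le> t" "t \<le> b" by auto
  have eq: "Y' t - V' t - (Y' s - V' s) = (Y' t - Y' s) - (V' t - V' s)"
    "rem (\<lambda>r. Y r - V r) (\<lambda>r. Y' r - V' r) s t = rem Y Y' s t - rem V V' s t"
    by (simp_all add: rem_def blinfun.bilinear_simps)
  show "norm (Y' t - V' t - (Y' s - V' s)) \<le> 2 * c * (t - s) powr \<alpha> \<and>
      norm (rem (\<lambda>r. Y r - V r) (\<lambda>r. Y' r - V' r) s t) \<le> 2 * c * ((t - s) powr \<alpha>)\<^sup>2"
    unfolding eq
    using holder_ctrlD[OF Y st] holder_ctrlD[OF V st]
      norm_triangle_ineq4[of "Y' t - Y' s" "V' t - V' s"] norm_triangle_ineq4[of "rem Y Y' s t" "rem V V' s t"]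
    by (simp add: mult.assoc)
qed

text \<open>Chosen to dominate all factors of one integration step: \<open>8 * M ^ 4\<close> for the
  derivative, \<open>6 * M ^ 5 * (S + 1)\<close> for the remainder, and
  \<open>2 * K\<close>.\<close>

definition kappa :: "real \<Rightarrow> real" where "kappa M = 8 * M ^ 5 * (S + 1)"

lemma kappa_pos: "0 < M \<Longrightarrow> 0 < kappa M"
  using S_pos by (simp add: kappa_def)

lemma kappa_ge:
  assumes "1 \<le> M"
  shows "8 * M ^ 5 \<le> kappa M" "8 * M ^ 5 * S \<le> kappa M"
  using assms S_pos by (simp_all add: kappa_def)

text \<open>From \<open>D' a = 0\<close> the derivative is at most
  \<open>c * (b - a) powr \<alpha>\<close>, so in the increment of \<open>D\<close> both the
  remainder and the term with \<open>X\<close> carry an additional power of the length. The two sum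
  up to the factor \<open>1 + K\<close>, at most \<open>2 * K\<close>.\<close>

lemma holder_ctrl_zero_start:
  assumes D: "holder_ctrl c a b D D'" and zero: "D a = 0" "D' a = 0" and c: "0 \<le> c"
    and q: "(b - a) powr \<alpha> \<le> 1" and ab: "0 \<le> a" "b \<le> T"
  defines "e \<equiv> 2 * K * c * (b - a) powr \<alpha>"
  shows "\<And>t. a \<le> t \<Longrightarrow> t \<le> b \<Longrightarrow> norm (D t) \<le> e"
    and "\<And>t. a \<le> t \<Longrightarrow> t \<le> b \<Longrightarrow> norm (D' t) \<le> e"
    and "incr e a b D"
proof -
  define q where "q = (b - a) powr \<alpha>"
  have q0: "0 \<le> q" by (simp add: q_def)
  have cq: "c * q \<le> e" "c * q + c * q * K = (1 + K) * (c * q)" "(1 + K) * (c * q) \<le> e"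
    using K c q0 mult_right_mono[of 1 "2 * K" "c * q"] mult_right_mono[of "1 + K" "2 * K" "c * q"]
    by (simp_all add: e_def q_def algebra_simps)
  have D': "norm (D' t) \<le> c * q" if t: "a \<le> t" "t \<le> b" for t
  proof -
    have "norm (D' t) \<le> c * (t - a) powr \<alpha>"
      using holder_ctrlD(1)[OF D, of a t] t zero by simp
    also have "\<dots> \<le> c * q"
      unfolding q_def using t c by (intro mult_left_mono powr_alpha_mono) auto
    finally show ?thesis .
  qed
  then show "\<And>t. a \<le> t \<Longrightarrow> t \<le> b \<Longrightarrow> norm (D' t) \<le> e"
    using cq(1) order_trans by blast
  have inc: "norm (D t - D s) \<le> e * (t - s) powr \<alpha>" if st: "a \<le> s" "s \<le> t" "t \<le> b" for s t
  proof -
    define p where "p = (t - s) powr \<alpha>"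
    have p: "0 \<le> p" "p \<le> q" unfolding p_def q_def using st by (auto intro: powr_alpha_mono)
    have "D t - D s = rem D D' s t + blinfun_apply (D' s) (X s t)" by (simp add: rem_def)
    also have "norm \<dots> \<le> c * p\<^sup>2 + (c * q) * (K * p)"
      using st ab holder_ctrlD(2)[OF D st] D'[of s] X_le[of s t]
      by (intro norm_triangle_le add_mono norm_blinfun_le) (auto simp: p_def)
    also have "c * p\<^sup>2 \<le> c * (q * p)"
      unfolding power2_eq_square using c p by (intro mult_left_mono mult_right_mono) auto
    also have "c * (q * p) + (c * q) * (K * p) = ((1 + K) * (c * q)) * p"
      by (simp add: algebra_simps)
    also have "\<dots> \<le> e * p" using cq p by (intro mult_right_mono) auto
    finally show ?thesis by (simp add: p_def)
  qed
  then show "incr e a b D" unfolding incr_def by blast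
  show "norm (D t) \<le> e" if t: "a \<le> t" "t \<le> b" for t
  proof -
    have e0: "0 \<le> e" using c K by (simp add: e_def)
    have "norm (D t) \<le> e * (t - a) powr \<alpha>" using inc[of a t] t zero by simp
    also have "\<dots> \<le> e * 1"
      using e0 powr_alpha_mono[of a a t b] t q by (intro mult_left_mono) auto
    finally show ?thesis by simp
  qed
qed

lemma small_interval:
  assumes M: "1 \<le> M" "K \<le> M" and small: "kappa M * (b - a) powr \<alpha> \<le> 1 / 2" and c: "0 \<le> c"
  shows "(b - a) powr \<alpha> \<le> 1" "2 * K * c * (b - a) powr \<alpha> \<le> c"
proof -
  define q where "q = (b - a) powr \<alpha>"
  have q: "0 \<le> q" by (simp add: q_def)
  have "2 * K \<le> 2 * M ^ 5" using M power_increasing[of 1 5 M] by simp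
  then have le: "2 * K \<le> kappa M" "1 \<le> kappa M"
    using kappa_ge(1)[OF M(1)] K by linarith+
  show "q \<le> 1" using mult_right_mono[OF le(2) q] small by (simp add: q_def)
  have "2 * K * q \<le> 1" using mult_right_mono[OF le(1) q] small by (simp add: q_def)
  from mult_left_mono[OF this c] show "2 * K * c * q \<le> c" by (simp add: ac_simps)
qed

text \<open>\<open>P\<close> and \<open>Q\<close> are only assumed close to the germs. So they can
  be the next Picard iterates as well as two solutions themselves, on an interval that need not
  start at 0.\<close>

lemma contraction:
  assumes Y: "ctrl M a b Y Y'" "incr M a b Y" and V: "ctrl M a b V V'" "incr M a b V"
    and M: "K \<le> M" and ab: "0 \<le> a" "a \<le> b" "b \<le> T"
    and small: "kappa M * (b - a) powr \<alpha> \<le> 1 / 2"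
    and start: "Y a = V a" "Y' a = V' a"
    and c: "0 \<le> c" and D: "holder_ctrl c a b (\<lambda>r. Y r - V r) (\<lambda>r. Y' r - V' r)"
    and P: "\<And>s t. \<lbrakk>a \<le> s; s \<le> t; t \<le> b\<rbrakk> \<Longrightarrow>
      norm (P t - P s - germ (\<lambda>r. F (Y r)) (FD Y Y') s t) \<le> B * (t - s) powr (3 * \<alpha>)"
    and Q: "\<And>s t. \<lbrakk>a \<le> s; s \<le> t; t \<le> b\<rbrakk> \<Longrightarrow>
      norm (Q t - Q s - germ (\<lambda>r. F (V r)) (FD V V') s t) \<le> B * (t - s) powr (3 * \<alpha>)"
  shows "holder_ctrl (c / 2) a b (\<lambda>r. P r - Q r) (\<lambda>r. (F (Y r) o\<^sub>L Z' r) - (F (V r) o\<^sub>L Z' r))"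
proof -
  have M1: "1 \<le> M" using K M by linarith
  define q where "q = (b - a) powr \<alpha>"
  have q: "0 \<le> q" by (simp add: q_def)
  define e where "e = 2 * K * c * q"
  note sm = small_interval[OF M1 M small c, folded q_def]
  have e: "0 \<le> e" "e \<le> c" using sm K c q by (auto simp: e_def)
  have eM: "e \<le> 2 * M * (c * q)"
    using mult_right_mono[OF M, of "2 * (c * q)"] c q by (simp add: e_def algebra_simps)
  have zs: "\<And>t. a \<le> t \<Longrightarrow> t \<le> b \<Longrightarrow> norm (Y t - V t) \<le> e"
      "\<And>t. a \<le> t \<Longrightarrow> t \<le> b \<Longrightarrow> norm (Y' t - V' t) \<le> e" "incr e a b (\<lambda>r. Y r - V r)"
    using holder_ctrl_zero_start[OF D _ _ c _ ab(1,3)] sm(1) start by (simp_all add: e_def q_def)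
  have cd: "ctrl (6 * M ^ 3 * c) a b (\<lambda>r. F (Y r) - F (V r)) (\<lambda>r. FD Y Y' r - FD V V' r)"
    "\<And>t. a \<le> t \<Longrightarrow> t \<le> b \<Longrightarrow> norm (F (Y t) - F (V t)) \<le> M * e"
    "\<And>t. a \<le> t \<Longrightarrow> t \<le> b \<Longrightarrow> norm (FD Y Y' t - FD V V' t) \<le> 2 * M\<^sup>2 * e"
    "incr (3 * M\<^sup>2 * e) a b (\<lambda>r. F (Y r) - F (V r))"
    using ctrl_compose_diff[OF Y V M e _ _ zs(3) D] zs(1,2) by blast+
  have pw: "M\<^sup>2 \<le> M ^ 3" "M ^ 3 \<le> M ^ 5" "M ^ 4 \<le> M ^ 5"
    using M1 by (auto intro: power_increasing)
  have kq: "kappa M * q * c \<le> c / 2"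
    using mult_right_mono[OF small c] by (simp add: q_def)
  have cq: "0 \<le> c * q" using c q by simp
  \<comment> \<open>The two germs subtract to the germ of the difference, for which
    \<open>P - Q\<close> is sewn with constant \<open>B + B\<close>; this improves to a multiple of
    \<open>c\<close>.\<close>
  have step: "norm ((P t - P s) - (Q t - Q s)
      - germ (\<lambda>r. F (Y r) - F (V r)) (\<lambda>r. FD Y Y' r - FD V V' r) s t) \<le> S * (6 * M ^ 3 * c) * ((t - s) powr \<alpha>) ^ 3"
    if st: "a \<le> s" "s \<le> t" "t \<le> b" for s t
  proof -
    have eq: "(P t - Q t) - (P s - Q s) - germ (\<lambda>r. F (Y r) - F (V r)) (\<lambda>r. FD Y Y' r - FD V V' r) s t
        = (P t - P s - germ (\<lambda>r. F (Y r)) (FD Y Y') s t) - (Q t - Q s - germ (\<lambda>r. F (V r)) (FD V V') s t)" for s t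
      unfolding germ_diff by simp
    have "norm ((P t - Q t) - (P s - Q s) - germ (\<lambda>r. F (Y r) - F (V r)) (\<lambda>r. FD Y Y' r - FD V V' r) s t)
        \<le> S * (6 * M ^ 3 * c) * ((t - s) powr \<alpha>) ^ 3"
    proof (rule germ_sewing_bound[OF cd(1) ab(1,3) _ st, where B = "B + B"])
      fix s t assume st: "a \<le> s" "s \<le> t" "t \<le> b"
      show "norm ((P t - Q t) - (P s - Q s) - germ (\<lambda>r. F (Y r) - F (V r)) (\<lambda>r. FD Y Y' r - FD V V' r) s t)
          \<le> (B + B) * (t - s) powr (3 * \<alpha>)"
        unfolding eq distrib_right by (intro norm_triangle_le_diff add_mono P Q st)
    qed
    then show ?thesis by (simp add: algebra_simps)
  qed
  show ?thesis
    unfolding holder_ctrl_def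
  proof (intro allI impI conjI)
    fix s t assume "a \<le> s \<and> s \<le> t \<and> t \<le> b"
    then have st: "a \<le> s" "s \<le> t" "t \<le> b" "s \<le> b" "a \<le> t" by auto
    then have st': "0 \<le> s" "t \<le> T" "0 \<le> t" "s \<le> T" using ab by auto
    define p where "p = (t - s) powr \<alpha>"
    have p: "0 \<le> p" "p \<le> q" unfolding p_def q_def using st by (auto intro: powr_alpha_mono)
    note z = Z'_incr_le[OF st'(1) st(2) st'(2), folded p_def] XX_le[OF st'(1) st(2) st'(2), folded p_def]
      Z_rem_le[OF st'(1) st(2) st'(2), folded p_def] Z'_le[OF st'(3,2)] Z'_le[OF st'(1,4)]
    let ?H = "\<lambda>r. F (Y r) - F (V r)"
    have comp: "(F (Y r) o\<^sub>L Z' r) - (F (V r) o\<^sub>L Z' r) = ?H r o\<^sub>L Z' r" for r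
      by (rule blinfun_eqI) (simp add: blinfun.bilinear_simps)
    have "norm ((?H t o\<^sub>L Z' t) - (?H s o\<^sub>L Z' s)) \<le> (3 * M\<^sup>2 * e * p) * K + M * e * (K * p)"
      by (rule norm_comp_increment_le[OF incrD[OF cd(4) st(1-3), folded p_def] z(4) cd(2)[OF st(1,4)] z(1)])
    also have "\<dots> = (3 * M\<^sup>2 * K + M * K) * (e * p)" by (simp add: algebra_simps)
    also have "\<dots> \<le> (4 * M ^ 3) * (2 * M * (c * q) * p)"
    proof (intro mult_mono mult_right_mono eM)
      have "M\<^sup>2 * K \<le> M\<^sup>2 * M" "M * K \<le> M * M" using M M1 by (auto intro: mult_left_mono)
      then show "3 * M\<^sup>2 * K + M * K \<le> 4 * M ^ 3"
        using pw(1) by (simp add: power2_eq_square power3_eq_cube)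
    qed (use p M1 e in auto)
    also have "\<dots> = (8 * M ^ 4) * (c * q) * p"
      by (simp add: algebra_simps power3_eq_cube power4_eq_xxxx)
    also have "\<dots> \<le> kappa M * (c * q) * p"
      using kappa_ge(1)[OF M1] pw(3) cq p by (intro mult_right_mono) auto
    also have "\<dots> \<le> c / 2 * p"
      using kq p by (intro mult_right_mono) (auto simp: ac_simps)
    finally show "norm ((F (Y t) o\<^sub>L Z' t) - (F (V t) o\<^sub>L Z' t) - ((F (Y s) o\<^sub>L Z' s) - (F (V s) o\<^sub>L Z' s)))
        \<le> c / 2 * (t - s) powr \<alpha>"
      unfolding comp p_def .
    \<comment> \<open>Removing the first level of \<open>Z\<close> from the germ leaves the sewing
      error, the remainder of \<open>Z\<close> and the second-level term. The last two have
      coefficients bounded by \<open>e\<close>.\<close>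
    have "rem (\<lambda>r. P r - Q r) (\<lambda>r. (F (Y r) o\<^sub>L Z' r) - (F (V r) o\<^sub>L Z' r)) s t
      = ((P t - P s) - (Q t - Q s) - germ ?H (\<lambda>r. FD Y Y' r - FD V V' r) s t)
        + blinfun_apply (?H s) (Z t - Z s - blinfun_apply (Z' s) (X s t))
        + blinfun_apply (Lam (FD Y Y' s - FD V V' s) (Z' s)) (XX s t)"
      unfolding comp by (simp add: rem_def germ_def blinfun.bilinear_simps)
    also have "norm \<dots> \<le> S * (6 * M ^ 3 * c) * p ^ 3 + M * e * (K * p\<^sup>2) + 2 * M\<^sup>2 * e * K * (K * p\<^sup>2)"
      by (rule norm_add3_le norm_blinfun_le norm_Lam_le step[OF st(1-3), folded p_def] cd(2)[OF st(1,4)]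
          cd(3)[OF st(1,4)] z)+
    also have "\<dots> = (6 * M ^ 3 * S * c) * (p * p\<^sup>2) + (M * K + 2 * M\<^sup>2 * (K * K)) * e * p\<^sup>2"
      by (simp add: algebra_simps power2_eq_square power3_eq_cube)
    \<comment> \<open>The cube \<open>p ^ 3\<close> gives up one factor \<open>p\<close> to
      \<open>q\<close>, and \<open>e\<close> contains \<open>q\<close> already, so every term is now
      a multiple of \<open>c * q * p\<^sup>2\<close>.\<close>
    also have "\<dots> \<le> (6 * M ^ 5 * S * c) * (q * p\<^sup>2) + (3 * M ^ 4) * (2 * M * (c * q)) * p\<^sup>2"
    proof (intro add_mono mult_mono mult_right_mono eM)
      have "M * K \<le> M * M" "M\<^sup>2 * (K * K) \<le> M\<^sup>2 * (M * M)"
        using M M1 K by (auto intro!: mult_mono)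
      moreover have "M * M \<le> M ^ 4" using power_increasing[of 2 4 M] M1 by (simp add: power2_eq_square)
      ultimately show "M * K + 2 * M\<^sup>2 * (K * K) \<le> 3 * M ^ 4"
        by (simp add: power2_eq_square power4_eq_xxxx)
      show "M ^ 3 \<le> M ^ 5" by (rule pw)
    qed (use p e S_pos M1 c q K in auto)
    also have "\<dots> = (6 * M ^ 5 * (S + 1)) * (c * q) * p\<^sup>2"
      by (simp add: algebra_simps eval_nat_numeral)
    also have "\<dots> \<le> kappa M * (c * q) * p\<^sup>2"
      unfolding kappa_def using cq p M1 S_pos by (intro mult_right_mono) auto
    also have "\<dots> \<le> c / 2 * p\<^sup>2"
      using kq p by (intro mult_right_mono) (auto simp: ac_simps)
    finally show "norm (rem (\<lambda>r. P r - Q r) (\<lambda>r. (F (Y r) o\<^sub>L Z' r) - (F (V r) o\<^sub>L Z' r)) s t)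
        \<le> c / 2 * ((t - s) powr \<alpha>)\<^sup>2"
      unfolding p_def .
  qed
qed

section \<open>Uniqueness of solutions\<close>

definition solves :: "real \<Rightarrow> 'w \<Rightarrow> (real \<Rightarrow> 'w) \<Rightarrow> (real \<Rightarrow> 'v \<Rightarrow>\<^sub>L 'w) \<Rightarrow> bool" where
  "solves \<tau> Y0 Y Y' \<longleftrightarrow> (\<forall>t\<in>{0..\<tau>}.
     Y t = Y0 + rough_integral tens XX (\<lambda>r. F (Y r)) (FD Y Y') Z Z' 0 t \<and> Y' t = F (Y t) o\<^sub>L Z' t)"

lemma solves_bound:
  assumes sol: "solves \<tau> Y0 Y Y'" and Y: "ctrl M 0 \<tau> Y Y'" "incr M 0 \<tau> Y" "K \<le> M" and \<tau>: "\<tau> \<le> T"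
    and st: "0 \<le> s" "s \<le> t" "t \<le> \<tau>"
  shows "norm (Y t - Y s - germ (\<lambda>r. F (Y r)) (FD Y Y') s t) \<le> S * (2 * M ^ 3) * (t - s) powr (3 * \<alpha>)"
  using rough_integral_bound[OF ctrl_compose[OF Y] \<tau> st] sol st
  by (simp add: solves_def powr_three_alpha)

text \<open>A solution is its own image, so \<open>contraction\<close> with \<open>P = Y\<close> and
  \<open>Q = V\<close> halves any bound on their distance, starting from \<open>2 * M\<close>.
  Agreement of the paths at \<open>a\<close> forces agreement of the derivatives there through the
  equation.\<close>

lemma solves_unique_step:
  assumes Y: "solves \<tau> Y0 Y Y'" "ctrl M 0 \<tau> Y Y'" "incr M 0 \<tau> Y"
    and V: "solves \<tau> Y0 V V'" "ctrl M 0 \<tau> V V'" "incr M 0 \<tau> V"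
    and M: "K \<le> M" and \<tau>: "\<tau> \<le> T" and ab: "0 \<le> a" "a \<le> b" "b \<le> \<tau>"
    and small: "kappa M * (b - a) powr \<alpha> \<le> 1 / 2" and start: "Y a = V a"
    and t: "a \<le> t" "t \<le> b"
  shows "Y t = V t"
proof -
  have M1: "1 \<le> M" using K M by linarith
  have res: "ctrl M a b W W'" "incr M a b W" if "ctrl M 0 \<tau> W W'" "incr M 0 \<tau> W" for W :: "real \<Rightarrow> 'w" and W'
    using that ab unfolding ctrl_def holder_ctrl_def incr_def by auto
  note Yr = res[OF Y(2,3)] and Vr = res[OF V(2,3)]
  have der: "Y' r = F (Y r) o\<^sub>L Z' r" "V' r = F (V r) o\<^sub>L Z' r" if "a \<le> r" "r \<le> b" for r
    using Y(1) V(1) that ab unfolding solves_def by auto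
  have start': "Y' a = V' a" using der[of a] ab start by simp
  have D: "holder_ctrl (2 * M / 2 ^ n) a b (\<lambda>r. Y r - V r) (\<lambda>r. Y' r - V' r)" for n
  proof (induction n)
    case 0
    then show ?case using holder_ctrl_diff Yr(1) Vr(1) unfolding ctrl_def by fastforce
  next
    case (Suc n)
    have "holder_ctrl (2 * M / 2 ^ n / 2) a b (\<lambda>r. Y r - V r) (\<lambda>r. (F (Y r) o\<^sub>L Z' r) - (F (V r) o\<^sub>L Z' r))"
      using ab \<tau> M1
      by (intro contraction[OF Yr Vr M _ _ _ small start start' _ Suc, where B = "S * (2 * M ^ 3)"]
          solves_bound[OF Y M \<tau>] solves_bound[OF V M \<tau>]) auto
    then have "holder_ctrl (2 * M / 2 ^ Suc n) a b (\<lambda>r. Y r - V r) (\<lambda>r. (F (Y r) o\<^sub>L Z' r) - (F (V r) o\<^sub>L Z' r))"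
      by (simp only: divide_divide_eq_left power_Suc2)
    then show ?case
      by (rule holder_ctrl_cong) (use der in auto)
  qed
  have "norm (Y t - V t) \<le> 2 * M / 2 ^ n" for n
  proof -
    have c: "0 \<le> 2 * M / 2 ^ n" using M1 by simp
    note sm = small_interval[OF M1 M small c]
    have "b \<le> T" using ab \<tau> by simp
    from holder_ctrl_zero_start(1)[OF D _ _ c sm(1) ab(1) this t] start start' sm(2)
    show ?thesis by simp
  qed
  then show ?thesis using eq_zero_if_norm_le_geometric by fastforce
qed

lemma exists_small:
  assumes "0 < k"
  shows "\<exists>h>0. \<forall>r. 0 \<le> r \<and> r \<le> h \<longrightarrow> k * r powr \<alpha> \<le> 1 / 2"
proof -
  define h where "h = (1 / (2 * k)) powr (1 / \<alpha>)"
  have h: "0 < h" "h powr \<alpha> = 1 / (2 * k)"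
    using assms alpha by (simp_all add: h_def powr_powr)
  have "k * r powr \<alpha> \<le> 1 / 2" if "0 \<le> r" "r \<le> h" for r
  proof -
    have "r powr \<alpha> \<le> h powr \<alpha>" using that alpha by (intro powr_mono2) auto
    then show ?thesis using assms h(2) by (simp add: field_simps)
  qed
  then show ?thesis using h(1) by blast
qed

lemma solves_unique:
  assumes Y: "solves \<tau> Y0 Y Y'" "ctrl M 0 \<tau> Y Y'" "incr M 0 \<tau> Y"
    and V: "solves \<tau> Y0 V V'" "ctrl M 0 \<tau> V V'" "incr M 0 \<tau> V"
    and M: "K \<le> M" and \<tau>: "0 \<le> \<tau>" "\<tau> \<le> T" and t: "0 \<le> t" "t \<le> \<tau>"
  shows "Y t = V t" "Y' t = V' t"
proof -
  have "0 < kappa M" using K M by (intro kappa_pos) linarith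
  then obtain h where h: "0 < h" "\<And>r. \<lbrakk>0 \<le> r; r \<le> h\<rbrakk> \<Longrightarrow> kappa M * r powr \<alpha> \<le> 1 / 2"
    using exists_small by blast
  \<comment> \<open>The initial value is not a separate condition; it comes from the equation at
    time 0, where the integral vanishes.\<close>
  have zero: "W 0 = Y0" if W: "solves \<tau> Y0 W W'" "ctrl M 0 \<tau> W W'" "incr M 0 \<tau> W" for W W'
    using rough_integral_refl[OF ctrl_compose[OF W(2,3) M] \<tau>(2,1)] W(1) \<tau>(1) unfolding solves_def by auto
  have eq: "Y t = V t" if "0 \<le> t" "t \<le> \<tau>" "t \<le> real n * h" for t n
    using that
  proof (induction n arbitrary: t)
    case 0
    then show ?case using zero[OF Y] zero[OF V] by simp
  next
    case (Suc n)
    show ?case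
    proof (cases "t \<le> real n * h")
      case True
      then show ?thesis using Suc by blast
    next
      case False
      have "Y (real n * h) = V (real n * h)" using Suc.IH[of "real n * h"] False Suc.prems h(1) by simp
      moreover have "0 \<le> real n * h" using h(1) by simp
      \<comment> \<open>The new interval ends at \<open>t\<close> itself, hence is no longer than
        \<open>h\<close> and stays inside \<open>[0, \<tau>]\<close>.\<close>
      moreover have "kappa M * (t - real n * h) powr \<alpha> \<le> 1 / 2"
        by (rule h(2)) (use False Suc.prems in \<open>simp_all add: distrib_right\<close>)
      ultimately show ?thesis
        using solves_unique_step[OF Y V M \<tau>(2), of "real n * h" t t] False Suc.prems by simp
    qed
  qed
  obtain n :: nat where "t / h < real n" using reals_Archimedean2 by blast
  then show 1: "Y t = V t" using eq[of t n] t h(1) by (simp add: field_simps)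
  show "Y' t = V' t" using Y(1) V(1) t 1 unfolding solves_def by auto
qed

end

section \<open>Existence\<close>

context rough_equation
begin

text \<open>Tightening the radii of the derivative and of the first increment to \<open>K\<^sup>2\<close> and \<open>K ^ 3 + 1\<close>
  makes the Picard map preserve this ball on short intervals, because the new Hoelder seminorms
  then do not involve the old ones up to a small factor.\<close>

definition ball_radius :: real where "ball_radius = 3 * K ^ 5"

definition picard_ball :: "real \<Rightarrow> (real \<Rightarrow> 'w) \<Rightarrow> (real \<Rightarrow> 'v \<Rightarrow>\<^sub>L 'w) \<Rightarrow> bool" where
  "picard_ball \<tau> Y Y' \<longleftrightarrow> holder_ctrl ball_radius 0 \<tau> Y Y' \<and>
     (\<forall>t. 0 \<le> t \<and> t \<le> \<tau> \<longrightarrow> norm (Y' t) \<le> K\<^sup>2) \<and> incr (K ^ 3 + 1) 0 \<tau> Y"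

text \<open>The last two polynomials are the coefficients that one Picard step yields for the
  derivative and for the remainder.\<close>

lemma ball_radius_ge:
  "K \<le> ball_radius" "K\<^sup>2 \<le> ball_radius" "K ^ 3 + 1 \<le> ball_radius" "1 \<le> ball_radius" "2 * K\<^sup>2 + K ^ 5 \<le> ball_radius"
  "1 + K\<^sup>2 + K ^ 5 \<le> ball_radius"
  using power_increasing[of 1 5 K] power_increasing[of 2 5 K] power_increasing[of 3 5 K] K
  by (simp_all add: ball_radius_def)

lemma picard_ballD:
  assumes "picard_ball \<tau> Y Y'"
  shows "ctrl ball_radius 0 \<tau> Y Y'" "incr ball_radius 0 \<tau> Y"
proof -
  show "ctrl ball_radius 0 \<tau> Y Y'"
    using assms ball_radius_ge(2) unfolding picard_ball_def ctrl_def by fastforce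
  show "incr ball_radius 0 \<tau> Y"
    unfolding incr_def
  proof (intro allI impI)
    fix s t assume "0 \<le> s \<and> s \<le> t \<and> t \<le> \<tau>"
    then have "norm (Y t - Y s) \<le> (K ^ 3 + 1) * (t - s) powr \<alpha>"
      using assms unfolding picard_ball_def incr_def by blast
    also have "\<dots> \<le> ball_radius * (t - s) powr \<alpha>"
      by (intro mult_right_mono ball_radius_ge) auto
    finally show "norm (Y t - Y s) \<le> ball_radius * (t - s) powr \<alpha>" .
  qed
qed

text \<open>The derivative contributes \<open>K\<^sup>2\<close> times the bound \<open>K\<close> on
  \<open>X\<close>, and the remainder contributes at most 1 by smallness of \<open>\<tau>\<close>;
  hence the radius \<open>K ^ 3 + 1\<close>.\<close>

lemma incr_of_rem:
  assumes M: "0 \<le> M" "M * \<tau> powr \<alpha> \<le> 1" and \<tau>: "\<tau> \<le> T" and st: "0 \<le> s" "s \<le> t" "t \<le> \<tau>"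
    and Y': "norm (Y' s) \<le> K\<^sup>2" and R: "norm (rem Y Y' s t) \<le> M * ((t - s) powr \<alpha>)\<^sup>2"
  shows "norm (Y t - Y s) \<le> (K ^ 3 + 1) * (t - s) powr \<alpha>"
proof -
  define p where "p = (t - s) powr \<alpha>"
  have p: "0 \<le> p" "p \<le> \<tau> powr \<alpha>" unfolding p_def using st powr_alpha_mono[of 0 s t \<tau>] by auto
  have "Y t - Y s = rem Y Y' s t + blinfun_apply (Y' s) (X s t)" by (simp add: rem_def)
  also have "norm \<dots> \<le> M * p\<^sup>2 + K\<^sup>2 * (K * p)"
    using st \<tau> R Y' X_le[of s t] by (intro norm_triangle_le add_mono norm_blinfun_le) (auto simp: p_def)
  also have "M * p\<^sup>2 = (M * p) * p" by (simp add: power2_eq_square)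
  also have "(M * p) * p \<le> 1 * p"
    using p M mult_left_mono[OF p(2) M(1)] by (intro mult_right_mono) auto
  finally show ?thesis by (simp add: p_def algebra_simps power2_eq_square power3_eq_cube)
qed

text \<open>The large radius enters only through the sewing error, whose spare factor
  \<open>p\<close> brings it below 1. All other terms use \<open>K\<close> and the two tight
  radii.\<close>

lemma picard_ball_step:
  assumes Y: "picard_ball \<tau> Y Y'" and \<tau>: "0 < \<tau>" "\<tau> \<le> T"
    and small: "kappa ball_radius * \<tau> powr \<alpha> \<le> 1 / 2"
  shows "picard_ball \<tau> (\<lambda>t. Y0 + rough_integral tens XX (\<lambda>r. F (Y r)) (FD Y Y') Z Z' 0 t)
    (\<lambda>t. F (Y t) o\<^sub>L Z' t)" (is "picard_ball \<tau> ?P ?P'")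
proof -
  let ?M = ball_radius
  define q where "q = \<tau> powr \<alpha>"
  have q: "0 \<le> q" by (simp add: q_def)
  note M1 = ball_radius_ge(4)
  have pw: "?M \<le> ?M ^ 5" "?M ^ 3 \<le> ?M ^ 5"
    using power_increasing[of 1 5 ?M] power_increasing[of 3 5 ?M] M1 by simp_all
  have "2 * ?M ^ 3 * S \<le> 8 * ?M ^ 5 * S"
    by (rule mult_right_mono) (use pw M1 S_pos in linarith)+
  then have "?M \<le> kappa ?M" "2 * ?M ^ 3 * S \<le> kappa ?M"
    using kappa_ge[OF M1] pw M1 by linarith+
  from this[THEN mult_right_mono, OF q] have Mq: "?M * q \<le> 1" "2 * ?M ^ 3 * S * q \<le> 1"
    using small by (auto simp: q_def)
  have P': "norm (?P' t) \<le> K\<^sup>2" if "0 \<le> t" "t \<le> \<tau>" for t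
    unfolding power2_eq_square
    using that \<tau> by (intro norm_blinfun_compose_le F_le Z'_le) auto
  have bounds: "norm (?P' t - ?P' s) \<le> ?M * (t - s) powr \<alpha> \<and> norm (rem ?P ?P' s t) \<le> ?M * ((t - s) powr \<alpha>)\<^sup>2"
    if st: "0 \<le> s" "s \<le> t" "t \<le> \<tau>" for s t
  proof -
    have st': "t \<le> T" "0 \<le> t" "s \<le> T" "s \<le> \<tau>" using st \<tau> by auto
    define p where "p = (t - s) powr \<alpha>"
    have p: "0 \<le> p" "p \<le> q" unfolding p_def q_def using st powr_alpha_mono[of 0 s t \<tau>] by auto
    note z = Z'_incr_le[OF st(1,2) st'(1), folded p_def] XX_le[OF st(1,2) st'(1), folded p_def]
      Z_rem_le[OF st(1,2) st'(1), folded p_def] Z'_le[OF st'(2,1)] Z'_le[OF st(1) st'(3)]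
    have Yi: "norm (Y t - Y s) \<le> (K ^ 3 + 1) * p" and Y's: "norm (Y' s) \<le> K\<^sup>2"
      using Y st st' unfolding picard_ball_def incr_def p_def by auto
    have "norm (?P' t - ?P' s) \<le> (K * ((K ^ 3 + 1) * p)) * K + K * (K * p)"
      by (rule norm_comp_increment_le[OF F_lip_le[OF Yi] z(4) F_le z(1)])
    also have "\<dots> = (2 * K\<^sup>2 + K ^ 5) * p"
      by (simp add: algebra_simps eval_nat_numeral)
    also have "\<dots> \<le> ?M * p" using p by (intro mult_right_mono ball_radius_ge) auto
    finally have 1: "norm (?P' t - ?P' s) \<le> ?M * p" .
    have sew: "norm (?P t - ?P s - germ (\<lambda>r. F (Y r)) (FD Y Y') s t) \<le> S * (2 * ?M ^ 3) * p ^ 3"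
      using rough_integral_bound[OF ctrl_compose[OF picard_ballD[OF Y] ball_radius_ge(1)] \<tau>(2) st]
      by (simp add: p_def)
    have "rem ?P ?P' s t = (?P t - ?P s - germ (\<lambda>r. F (Y r)) (FD Y Y') s t)
        + blinfun_apply (F (Y s)) (Z t - Z s - blinfun_apply (Z' s) (X s t))
        + blinfun_apply (Lam (FD Y Y' s) (Z' s)) (XX s t)"
      by (simp add: rem_def germ_def blinfun.bilinear_simps)
    also have "norm \<dots> \<le> S * (2 * ?M ^ 3) * p ^ 3 + K * (K * p\<^sup>2) + (K * K\<^sup>2) * K * (K * p\<^sup>2)"
      by (rule norm_add3_le norm_Lam_le norm_blinfun_le norm_blinfun_compose_le sew F_le DF_le z Y's)+
    also have "\<dots> = (2 * ?M ^ 3 * S) * p * p\<^sup>2 + (K\<^sup>2 + K ^ 5) * p\<^sup>2"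
      by (simp add: algebra_simps eval_nat_numeral)
    also have "(2 * ?M ^ 3 * S) * p \<le> (2 * ?M ^ 3 * S) * q"
      using p S_pos M1 by (intro mult_left_mono) auto
    also have "\<dots> \<le> 1" by (rule Mq)
    also have "1 * p\<^sup>2 + (K\<^sup>2 + K ^ 5) * p\<^sup>2 = (1 + K\<^sup>2 + K ^ 5) * p\<^sup>2" by (simp add: algebra_simps)
    also have "\<dots> \<le> ?M * p\<^sup>2" by (intro mult_right_mono ball_radius_ge) auto
    finally have 2: "norm (rem ?P ?P' s t) \<le> ?M * p\<^sup>2"
      using p by (simp add: mult_right_mono)
    show ?thesis using 1 2 by (simp add: p_def)
  qed
  have "norm (?P t - ?P s) \<le> (K ^ 3 + 1) * (t - s) powr \<alpha>" if st: "0 \<le> s" "s \<le> t" "t \<le> \<tau>" for s t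
    by (rule incr_of_rem[where M = ?M and Y = ?P and Y' = ?P'])
      (use st \<tau> bounds[OF st] P'[of s] Mq M1 in \<open>auto simp: q_def\<close>)
  then show ?thesis
    using bounds P' unfolding picard_ball_def holder_ctrl_def incr_def by blast
qed

lemma X_refl: "0 \<le> s \<Longrightarrow> s \<le> T \<Longrightarrow> X s s = 0"
  using chen1[of s s s] by simp

text \<open>The affine path in \<open>X\<close> has zero remainder and already the derivative at 0
  that all later iterates have. A constant path with derivative 0 could violate the common start
  required by \<open>contraction\<close>.\<close>

lemma picard_ball_start:
  assumes \<tau>: "\<tau> \<le> T"
  shows "picard_ball \<tau> (\<lambda>t. Y0 + blinfun_apply (F Y0 o\<^sub>L Z' 0) (X 0 t)) (\<lambda>t. F Y0 o\<^sub>L Z' 0)"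
    (is "picard_ball \<tau> ?Y ?Y'")
proof (cases "0 \<le> \<tau>")
  case True
  have Z0: "norm (F Y0 o\<^sub>L Z' 0) \<le> K\<^sup>2"
    unfolding power2_eq_square using True \<tau> by (intro norm_blinfun_compose_le F_le Z'_le) auto
  have inc: "?Y t - ?Y s = blinfun_apply (F Y0 o\<^sub>L Z' 0) (X s t)" if "0 \<le> s" "s \<le> t" "t \<le> \<tau>" for s t
    using chen1[of 0 s t] that \<tau> by (simp add: blinfun.bilinear_simps)
  have "norm (?Y t - ?Y s) \<le> (K ^ 3 + 1) * (t - s) powr \<alpha>" if st: "0 \<le> s" "s \<le> t" "t \<le> \<tau>" for s t
  proof -
    have "norm (?Y t - ?Y s) \<le> K\<^sup>2 * (K * (t - s) powr \<alpha>)"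
      unfolding inc[OF st] using st \<tau> by (intro norm_blinfun_le Z0 X_le) auto
    also have "\<dots> \<le> (K ^ 3 + 1) * (t - s) powr \<alpha>"
      by (simp add: algebra_simps power2_eq_square power3_eq_cube)
    finally show ?thesis .
  qed
  moreover have "rem ?Y ?Y' s t = 0" if "0 \<le> s" "s \<le> t" "t \<le> \<tau>" for s t
    using inc[OF that] by (simp add: rem_def)
  ultimately show ?thesis
    using Z0 ball_radius_ge(4) unfolding picard_ball_def holder_ctrl_def incr_def by simp
qed (simp add: picard_ball_def holder_ctrl_def incr_def)

text \<open>All conditions are non-strict inequalities between values at one or two times, so
  pointwise convergence preserves them.\<close>

lemma picard_ball_limit:
  assumes ball: "\<And>n. picard_ball \<tau> (y n) (y' n)"
    and lim: "\<And>t. 0 \<le> t \<Longrightarrow> t \<le> \<tau> \<Longrightarrow> (\<lambda>n. y n t) \<longlonglongrightarrow> Y t"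
      "\<And>t. 0 \<le> t \<Longrightarrow> t \<le> \<tau> \<Longrightarrow> (\<lambda>n. y' n t) \<longlonglongrightarrow> Y' t"
  shows "picard_ball \<tau> Y Y'"
proof -
  have bd: "norm x \<le> c" if "f \<longlonglongrightarrow> x" "\<And>n. norm (f n) \<le> c"
    for f :: "nat \<Rightarrow> 'z::real_normed_vector" and x c
    using LIMSEQ_le_const2[OF tendsto_norm[OF that(1)]] that(2) by blast
  show ?thesis
    unfolding picard_ball_def holder_ctrl_def incr_def
  proof (intro conjI allI impI)
    fix t assume "0 \<le> t \<and> t \<le> \<tau>"
    then show "norm (Y' t) \<le> K\<^sup>2"
      using ball unfolding picard_ball_def by (intro bd[OF lim(2)]) auto
  next
    fix s t assume "0 \<le> s \<and> s \<le> t \<and> t \<le> \<tau>"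
    then have st: "0 \<le> s" "s \<le> t" "t \<le> \<tau>" "0 \<le> t" "s \<le> \<tau>" by auto
    note L = lim(1)[OF st(1,5)] lim(1)[OF st(4,3)] lim(2)[OF st(1,5)] lim(2)[OF st(4,3)]
    show "norm (Y t - Y s) \<le> (K ^ 3 + 1) * (t - s) powr \<alpha>"
      by (rule bd[OF tendsto_diff[OF L(2,1)]]) (use ball st in \<open>auto simp: picard_ball_def incr_def\<close>)
    show "norm (Y' t - Y' s) \<le> ball_radius * (t - s) powr \<alpha>"
      by (rule bd[OF tendsto_diff[OF L(4,3)]]) (use ball st in \<open>auto simp: picard_ball_def holder_ctrl_def\<close>)
    have "(\<lambda>n. rem (y n) (y' n) s t) \<longlonglongrightarrow> rem Y Y' s t"
      unfolding rem_def by (intro tendsto_intros L)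
    then show "norm (rem Y Y' s t) \<le> ball_radius * ((t - s) powr \<alpha>)\<^sup>2"
      by (rule bd) (use ball st in \<open>auto simp: picard_ball_def holder_ctrl_def\<close>)
  qed
qed

lemma F_tendsto: "f \<longlonglongrightarrow> x \<Longrightarrow> (\<lambda>n. F (f n)) \<longlonglongrightarrow> F x"
  by (rule isCont_tendsto_compose[OF has_derivative_continuous[OF F_der]])

lemma DF_tendsto: "f \<longlonglongrightarrow> x \<Longrightarrow> (\<lambda>n. DF (f n)) \<longlonglongrightarrow> DF x"
  by (rule isCont_tendsto_compose[OF has_derivative_continuous[OF DF_der]])

lemma germ_tendsto:
  assumes "(\<lambda>n. y n s) \<longlonglongrightarrow> Y s" "(\<lambda>n. y' n s) \<longlonglongrightarrow> Y' s"
  shows "(\<lambda>n. germ (\<lambda>r. F (y n r)) (FD (y n) (y' n)) s t) \<longlonglongrightarrow> germ (\<lambda>r. F (Y r)) (FD Y Y') s t"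
  unfolding germ_def
  by (intro tendsto_intros F_tendsto DF_tendsto assms
      bounded_bilinear.tendsto[OF bounded_bilinear_blinfun_tensor[OF tens]]
      bounded_bilinear.tendsto[OF bounded_bilinear_blinfun_compose])

lemma solution_exists:
  assumes \<tau>: "0 < \<tau>" "\<tau> \<le> T" and small: "kappa ball_radius * \<tau> powr \<alpha> \<le> 1 / 2"
  shows "\<exists>Y Y'. picard_ball \<tau> Y Y' \<and> solves \<tau> Y0 Y Y'"
proof -
  let ?M = ball_radius
  note M1 = ball_radius_ge(4) and KM = ball_radius_ge(1)
  define I where "I = (\<lambda>Y Y'. rough_integral tens XX (\<lambda>r. F (Y r)) (FD Y Y') Z Z' 0)"
  define \<Phi> where "\<Phi> = (\<lambda>(Y, Y'). (\<lambda>t. Y0 + I Y Y' t, \<lambda>t. F (Y t) o\<^sub>L Z' t))"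
  define it where "it = (\<lambda>n. (\<Phi> ^^ n) (\<lambda>t. Y0 + blinfun_apply (F Y0 o\<^sub>L Z' 0) (X 0 t), \<lambda>t. F Y0 o\<^sub>L Z' 0))"
  define y y' where "y = (\<lambda>n. fst (it n))" and "y' = (\<lambda>n. snd (it n))"
  have it_Suc: "y (Suc n) = (\<lambda>t. Y0 + I (y n) (y' n) t)" "y' (Suc n) = (\<lambda>t. F (y n t) o\<^sub>L Z' t)" for n
    by (simp_all add: y_def y'_def it_def \<Phi>_def split_beta)
  have ball: "picard_ball \<tau> (y n) (y' n)" for n
  proof (induction n)
    case 0
    show ?case using picard_ball_start[OF \<tau>(2)] by (simp add: y_def y'_def it_def)
  next
    case (Suc n)
    then show ?case unfolding it_Suc I_def by (rule picard_ball_step[OF _ \<tau> small])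
  qed
  note bd = picard_ballD[OF ball]
  note comp = ctrl_compose[OF bd KM]
  have zero: "y n 0 = Y0 \<and> y' n 0 = F Y0 o\<^sub>L Z' 0" for n
  proof (induction n)
    case 0
    show ?case using \<tau> X_refl[of 0] by (simp add: y_def y'_def it_def blinfun.zero_right)
  next
    case (Suc n)
    then show ?case using \<tau> rough_integral_refl[OF comp \<tau>(2)] by (simp add: it_Suc I_def)
  qed
  \<comment> \<open>The constant does not depend on \<open>n\<close>, which is what lets this
    estimate pass to the limit.\<close>
  have davie: "norm (y (Suc n) t - y (Suc n) s - germ (\<lambda>r. F (y n r)) (FD (y n) (y' n)) s t)
      \<le> S * (2 * ?M ^ 3) * (t - s) powr (3 * \<alpha>)" if st: "0 \<le> s" "s \<le> t" "t \<le> \<tau>" for n s t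
    using rough_integral_bound[OF comp \<tau>(2) st, of n] st by (simp add: it_Suc I_def powr_three_alpha)
  have near: "holder_ctrl (2 * ?M / 2 ^ n) 0 \<tau> (\<lambda>r. y (Suc n) r - y n r) (\<lambda>r. y' (Suc n) r - y' n r)" for n
  proof (induction n)
    case 0
    then show ?case
      using holder_ctrl_diff[of ?M 0 \<tau> "y (Suc 0)" "y' (Suc 0)" "y 0" "y' 0"] bd(1) unfolding ctrl_def by simp
  next
    case (Suc n)
    have "holder_ctrl (2 * ?M / 2 ^ n / 2) 0 \<tau> (\<lambda>r. y (Suc (Suc n)) r - y (Suc n) r)
        (\<lambda>r. (F (y (Suc n) r) o\<^sub>L Z' r) - (F (y n r) o\<^sub>L Z' r))"
      by (rule contraction[OF bd bd KM _ _ \<tau>(2) _ _ _ _ Suc davie davie]) (use \<tau> small M1 zero in auto)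
    then show ?case by (simp only: divide_divide_eq_left power_Suc2 it_Suc(2))
  qed
  have steps: "norm (y (Suc n) t - y n t) \<le> 2 * ?M / 2 ^ n \<and> norm (y' (Suc n) t - y' n t) \<le> 2 * ?M / 2 ^ n"
    if t: "0 \<le> t" "t \<le> \<tau>" for n t
  proof -
    have c: "0 \<le> 2 * ?M / 2 ^ n" using M1 by simp
    have small': "kappa ?M * (\<tau> - 0) powr \<alpha> \<le> 1 / 2" using small by simp
    note sm = small_interval[OF M1 KM small' c]
    have z: "y (Suc n) 0 - y n 0 = 0" "y' (Suc n) 0 - y' n 0 = 0" using zero by simp_all
    note zs = holder_ctrl_zero_start(1,2)[OF near z c sm(1) order_refl \<tau>(2) t]
    show ?thesis using zs sm(2) by (auto intro: order_trans)
  qed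
  define Y Y' where "Y = (\<lambda>t. lim (\<lambda>n. y n t))" and "Y' = (\<lambda>t. lim (\<lambda>n. y' n t))"
  have lim: "(\<lambda>n. y n t) \<longlonglongrightarrow> Y t" "(\<lambda>n. y' n t) \<longlonglongrightarrow> Y' t" if "0 \<le> t" "t \<le> \<tau>" for t
    using convergent_geometric_increments[of "\<lambda>n. y n t"] convergent_geometric_increments[of "\<lambda>n. y' n t"] steps[OF that]
    unfolding Y_def Y'_def by (auto simp: convergent_LIMSEQ_iff)
  have "picard_ball \<tau> Y Y'" by (rule picard_ball_limit[OF ball lim])
  moreover have "solves \<tau> Y0 Y Y'"
    unfolding solves_def
  proof (intro ballI conjI)
    \<comment> \<open>Iterate \<open>Suc n\<close> is close to the germ of iterate \<open>n\<close>;
      the shift disappears in the limit, and the estimate then identifies \<open>Y\<close> as the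
      integral.\<close>
    have dav: "norm (Y t - Y s - germ (\<lambda>r. F (Y r)) (FD Y Y') s t) \<le> S * (2 * ?M ^ 3) * (t - s) powr (3 * \<alpha>)"
      if st: "0 \<le> s" "s \<le> t" "t \<le> \<tau>" for s t
    proof (rule LIMSEQ_le_const2)
      show "(\<lambda>n. norm (y (Suc n) t - y (Suc n) s - germ (\<lambda>r. F (y n r)) (FD (y n) (y' n)) s t)) \<longlonglongrightarrow>
          norm (Y t - Y s - germ (\<lambda>r. F (Y r)) (FD Y Y') s t)"
        using st by (intro tendsto_intros germ_tendsto LIMSEQ_Suc lim) auto
    qed (use davie st in blast)
    fix t assume t: "t \<in> {0..\<tau>}"
    have "Y 0 = Y0" using lim(1)[of 0] \<tau> zero by (simp add: LIMSEQ_const_iff)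
    then show "Y t = Y0 + rough_integral tens XX (\<lambda>r. F (Y r)) (FD Y Y') Z Z' 0 t"
      using rough_integral_eqI[OF dav, where s = 0 and t = t] t by simp
    have "(\<lambda>n. y' (Suc n) t) \<longlonglongrightarrow> (F (Y t) o\<^sub>L Z' t)"
      unfolding it_Suc using t
      by (intro bounded_bilinear.tendsto[OF bounded_bilinear_blinfun_compose] F_tendsto lim tendsto_const) auto
    moreover have "(\<lambda>n. y' (Suc n) t) \<longlonglongrightarrow> Y' t" using t by (intro LIMSEQ_Suc lim) auto
    ultimately show "Y' t = F (Y t) o\<^sub>L Z' t" by (rule LIMSEQ_unique[symmetric])
  qed
  ultimately show ?thesis by blast
qed

end

section \<open>From finite seminorms to explicit constants, and the theorem\<close>

lemma powr_double: "(x::real) powr (2 * \<beta>) = (x powr \<beta>)\<^sup>2"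
  by (simp add: power2_eq_square flip: powr_add)

text \<open>The seminorm only sees \<open>s < t\<close>, while the bound at \<open>s = t\<close>
  says that \<open>R\<close> vanishes on the diagonal; this is supplied by
  \<open>refl\<close>.\<close>

lemma holder_finiteD:
  assumes R: "holder_finite \<beta> \<tau> R" and refl: "\<And>s. \<lbrakk>0 \<le> s; s \<le> \<tau>\<rbrakk> \<Longrightarrow> R s s = 0"
  obtains C where "0 \<le> C" "\<And>s t. \<lbrakk>0 \<le> s; s \<le> t; t \<le> \<tau>\<rbrakk> \<Longrightarrow> norm (R s t) \<le> C * (t - s) powr \<beta>"
proof -
  obtain C where C: "norm (R s t) / (t - s) powr \<beta> \<le> C" if "0 \<le> s" "s < t" "t \<le> \<tau>" for s t
    using R unfolding holder_finite_def bdd_above_def by blast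
  have "norm (R s t) \<le> max C 0 * (t - s) powr \<beta>" if st: "0 \<le> s" "s \<le> t" "t \<le> \<tau>" for s t
  proof (cases "s = t")
    case True
    then show ?thesis using refl st by simp
  next
    case False
    then have "norm (R s t) \<le> C * (t - s) powr \<beta>" using C[of s t] st by (simp add: divide_le_eq)
    also have "\<dots> \<le> max C 0 * (t - s) powr \<beta>" by (intro mult_right_mono) auto
    finally show ?thesis .
  qed
  then show thesis using that[of "max C 0"] by simp
qed

lemma holder_finiteI:
  assumes "\<And>s t. \<lbrakk>0 \<le> s; s < t; t \<le> \<tau>\<rbrakk> \<Longrightarrow> norm (R s t) \<le> C * (t - s) powr \<beta>"
  shows "holder_finite \<beta> \<tau> R"
  unfolding holder_finite_def
  using assms by (intro bdd_aboveI[of _ C]) (auto simp: divide_le_eq)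

lemma controlled_bounds:
  fixes Y :: "real \<Rightarrow> 'e::banach" and Y' :: "real \<Rightarrow> 'v::banach \<Rightarrow>\<^sub>L 'e"
  assumes Y: "controlled \<alpha> X \<tau> Y Y'" and \<alpha>: "0 < \<alpha>" and \<tau>: "0 \<le> \<tau>"
    and X: "0 \<le> C" "\<And>s t. \<lbrakk>0 \<le> s; s \<le> t; t \<le> \<tau>\<rbrakk> \<Longrightarrow> norm (X s t) \<le> C * (t - s) powr \<alpha>"
  obtains M where "\<And>t. \<lbrakk>0 \<le> t; t \<le> \<tau>\<rbrakk> \<Longrightarrow> norm (Y' t) \<le> M"
    "\<And>s t. \<lbrakk>0 \<le> s; s \<le> t; t \<le> \<tau>\<rbrakk> \<Longrightarrow> norm (Y' t - Y' s) \<le> M * (t - s) powr \<alpha>"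
    "\<And>s t. \<lbrakk>0 \<le> s; s \<le> t; t \<le> \<tau>\<rbrakk> \<Longrightarrow> norm (Y t - Y s) \<le> M * (t - s) powr \<alpha>"
    "\<And>s t. \<lbrakk>0 \<le> s; s \<le> t; t \<le> \<tau>\<rbrakk> \<Longrightarrow>
      norm (Y t - Y s - blinfun_apply (Y' s) (X s t)) \<le> M * ((t - s) powr \<alpha>)\<^sup>2"
proof -
  have "X s s = 0" if "0 \<le> s" "s \<le> \<tau>" for s using X(2)[of s s] that by simp
  then obtain C2 where C2: "0 \<le> C2" "\<And>s t. \<lbrakk>0 \<le> s; s \<le> t; t \<le> \<tau>\<rbrakk> \<Longrightarrow>
      norm (Y t - Y s - blinfun_apply (Y' s) (X s t)) \<le> C2 * (t - s) powr (2 * \<alpha>)"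
    using Y unfolding controlled_def
    by (elim conjE holder_finiteD[of _ _ "\<lambda>s t. Y t - Y s - blinfun_apply (Y' s) (X s t)"])
      (auto simp: blinfun.zero_right)
  obtain C1 where C1: "0 \<le> C1" "\<And>s t. \<lbrakk>0 \<le> s; s \<le> t; t \<le> \<tau>\<rbrakk> \<Longrightarrow> norm (Y' t - Y' s) \<le> C1 * (t - s) powr \<alpha>"
    using Y unfolding controlled_def by (elim conjE holder_finiteD[of _ _ "\<lambda>s t. Y' t - Y' s"]) auto
  define q where "q = \<tau> powr \<alpha>"
  define B where "B = norm (Y' 0) + C1 * q"
  \<comment> \<open>The summands are the bounds for the derivative, its increments, the remainder
    and the path increments, so a single constant covers all four.\<close>
  define M where "M = B + C1 + C2 + (C2 * q + B * C)"
  have q: "0 \<le> q" by (simp add: q_def)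
  have B0: "0 \<le> B" using C1(1) q by (simp add: B_def)
  have nn: "0 \<le> C2 * q + B * C" using C2(1) q B0 X(1) by simp
  have p: "(t - s) powr \<alpha> \<le> q" if "0 \<le> s" "s \<le> t" "t \<le> \<tau>" for s t
    unfolding q_def using that \<alpha> by (intro powr_mono2) auto
  have B: "norm (Y' t) \<le> B" if t: "0 \<le> t" "t \<le> \<tau>" for t
  proof -
    have "norm (Y' t) \<le> norm (Y' 0) + norm (Y' t - Y' 0)" by (rule norm_triangle_sub)
    also have "norm (Y' t - Y' 0) \<le> C1 * (t - 0) powr \<alpha>" using C1(2)[of 0 t] t by simp
    also have "C1 * (t - 0) powr \<alpha> \<le> C1 * q" using p[of 0 t] t C1(1) by (intro mult_left_mono) auto
    finally show ?thesis by (simp add: B_def)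
  qed
  show thesis
  proof
    fix t assume "0 \<le> t" "t \<le> \<tau>"
    then show "norm (Y' t) \<le> M" using B[of t] C1(1) C2(1) nn by (simp add: M_def)
  next
    fix s t assume st: "0 \<le> s" "s \<le> t" "t \<le> \<tau>"
    let ?p = "(t - s) powr \<alpha>"
    have "C1 * ?p \<le> M * ?p" using B0 C2(1) nn by (intro mult_right_mono) (auto simp: M_def)
    with C1(2)[OF st] show "norm (Y' t - Y' s) \<le> M * ?p" by linarith
    have "C2 * ?p\<^sup>2 \<le> M * ?p\<^sup>2" using B0 C1(1) nn by (intro mult_right_mono) (auto simp: M_def)
    with C2(2)[OF st] show "norm (Y t - Y s - blinfun_apply (Y' s) (X s t)) \<le> M * ?p\<^sup>2"
      by (simp add: powr_double)
    have "Y t - Y s = (Y t - Y s - blinfun_apply (Y' s) (X s t)) + blinfun_apply (Y' s) (X s t)" by simp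
    also have "norm \<dots> \<le> C2 * ?p\<^sup>2 + B * (C * ?p)"
      using C2(2)[OF st] B[of s] X(2)[OF st] st
      by (intro norm_triangle_le add_mono norm_blinfun_le) (auto simp: powr_double)
    also have "C2 * ?p\<^sup>2 \<le> C2 * (q * ?p)"
      unfolding power2_eq_square using p[OF st] C2(1) by (intro mult_left_mono mult_right_mono) auto
    also have "C2 * (q * ?p) + B * (C * ?p) = (C2 * q + B * C) * ?p" by (simp add: algebra_simps)
    also have "\<dots> \<le> M * ?p" using B0 C1(1) C2(1) by (intro mult_right_mono) (auto simp: M_def)
    finally show "norm (Y t - Y s) \<le> M * ?p" by simp
  qed
qed

theorem theorem3p8:
  fixes \<alpha> T :: real
    and tens :: "'v::banach \<Rightarrow> 'v \<Rightarrow> 't::banach"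
    and X :: "real \<Rightarrow> real \<Rightarrow> 'v" and XX :: "real \<Rightarrow> real \<Rightarrow> 't"
    and Z :: "real \<Rightarrow> 'u::banach" and Z' :: "real \<Rightarrow> 'v \<Rightarrow>\<^sub>L 'u"
    and F :: "'w::banach \<Rightarrow> 'u \<Rightarrow>\<^sub>L 'w" and Y0 :: 'w
  assumes "1/3 < \<alpha>" and "\<alpha> \<le> 1/2" and "0 < T"
    and "projective_tensor tens"
    and "rough_path tens \<alpha> T X XX"
    and "controlled \<alpha> X T Z Z'"
    and "C3_b F"
  shows "\<exists>\<tau>0>0. \<forall>\<tau>. 0 < \<tau> \<and> \<tau> < \<tau>0 \<and> \<tau> < T \<longrightarrow>
    (\<exists>Y Y'. controlled_solution tens \<alpha> X XX Z Z' F Y0 \<tau> Y Y' \<and>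
      (\<forall>V V'. controlled_solution tens \<alpha> X XX Z Z' F Y0 \<tau> V V' \<longrightarrow>
         (\<forall>t\<in>{0..\<tau>}. V t = Y t \<and> V' t = Y' t)))"
proof -
  have \<alpha>: "0 < \<alpha>" using assms(1) by linarith
  have bt: "bilinear tens" using assms(4) unfolding projective_tensor_def by blast
  have chen: "X s t = X s u + X u t" "XX s t = XX s u + XX u t + tens (X s u) (X u t)"
    if "0 \<le> s" "s \<le> u" "u \<le> t" "t \<le> T" for s u t
    using assms(5) that unfolding rough_path_def by blast+
  have X0: "X s s = 0" if "0 \<le> s" "s \<le> T" for s using chen(1)[of s s s] that by simp
  have XX0: "XX s s = 0" if "0 \<le> s" "s \<le> T" for s
    using chen(2)[of s s s] that X0[of s] bilinear_lzero[OF bt] by simp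
  have hX: "holder_finite \<alpha> T X" "holder_finite (2 * \<alpha>) T XX"
    using assms(5) unfolding rough_path_def by blast+
  obtain CX where CX: "0 \<le> CX" "\<And>s t. \<lbrakk>0 \<le> s; s \<le> t; t \<le> T\<rbrakk> \<Longrightarrow> norm (X s t) \<le> CX * (t - s) powr \<alpha>"
    by (rule holder_finiteD[OF hX(1)]) (rule X0, assumption+, rule that, assumption, blast)
  obtain CXX where CXX: "0 \<le> CXX" "\<And>s t. \<lbrakk>0 \<le> s; s \<le> t; t \<le> T\<rbrakk> \<Longrightarrow> norm (XX s t) \<le> CXX * (t - s) powr (2 * \<alpha>)"
    by (rule holder_finiteD[OF hX(2)]) (rule XX0, assumption+, rule that, assumption, blast)
  obtain CZ where CZ: "\<And>t. \<lbrakk>0 \<le> t; t \<le> T\<rbrakk> \<Longrightarrow> norm (Z' t) \<le> CZ"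
    "\<And>s t. \<lbrakk>0 \<le> s; s \<le> t; t \<le> T\<rbrakk> \<Longrightarrow> norm (Z' t - Z' s) \<le> CZ * (t - s) powr \<alpha>"
    "\<And>s t. \<lbrakk>0 \<le> s; s \<le> t; t \<le> T\<rbrakk> \<Longrightarrow> norm (Z t - Z s) \<le> CZ * (t - s) powr \<alpha>"
    "\<And>s t. \<lbrakk>0 \<le> s; s \<le> t; t \<le> T\<rbrakk> \<Longrightarrow>
      norm (Z t - Z s - blinfun_apply (Z' s) (X s t)) \<le> CZ * ((t - s) powr \<alpha>)\<^sup>2"
    by (rule controlled_bounds[OF assms(6) \<alpha> less_imp_le[OF assms(3)] CX(1)])
      (rule CX(2), assumption+, rule that, blast+)
  obtain c0 c1 c2 c3 where c: "\<And>x. norm (F x) \<le> c0" "\<And>x. norm (frechet_D F x) \<le> c1"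
    "\<And>x. norm (frechet_D (frechet_D F) x) \<le> c2" "\<And>x. norm (frechet_D (frechet_D (frechet_D F)) x) \<le> c3"
    using assms(7) unfolding C3_b_def bounded_iff by blast
  have der: "(F has_derivative blinfun_apply (frechet_D F x)) (at x)"
    "(frechet_D F has_derivative blinfun_apply (frechet_D (frechet_D F) x)) (at x)"
    "(frechet_D (frechet_D F) has_derivative blinfun_apply (frechet_D (frechet_D (frechet_D F)) x)) (at x)" for x
    using assms(7) unfolding C3_b_def by (blast intro: frechet_D_has_derivative)+
  define K where "K = Max {1, CX, CXX, CZ, c0, c1, c2, c3}"
  have K: "1 \<le> K" "CX \<le> K" "CXX \<le> K" "CZ \<le> K" "c0 \<le> K" "c1 \<le> K" "c2 \<le> K" "c3 \<le> K"
    unfolding K_def by (intro Max_ge; simp)+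
  have Kp: "x \<le> K * p" if "x \<le> k * p" "k \<le> K" "0 \<le> p" for x k p
    using that mult_right_mono[of k K p] by linarith
  have driver: "norm (X s t) \<le> K * (t - s) powr \<alpha>" "norm (XX s t) \<le> K * ((t - s) powr \<alpha>)\<^sup>2"
    "norm (Z' t - Z' s) \<le> K * (t - s) powr \<alpha>" "norm (Z t - Z s) \<le> K * (t - s) powr \<alpha>"
    "norm (Z t - Z s - blinfun_apply (Z' s) (X s t)) \<le> K * ((t - s) powr \<alpha>)\<^sup>2"
    if "0 \<le> s" "s \<le> t" "t \<le> T" for s t
    using Kp[OF CX(2)[OF that] K(2)] Kp[OF CXX(2)[OF that] K(3)] Kp[OF CZ(2)[OF that] K(4)]
      Kp[OF CZ(3)[OF that] K(4)] Kp[OF CZ(4)[OF that] K(4)] by (simp_all add: powr_double)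
  have Z'_K: "norm (Z' t) \<le> K" if "0 \<le> t" "t \<le> T" for t
    using CZ(1)[OF that] K(4) by linarith
  have field_K: "norm (F x) \<le> K" "norm (frechet_D F x) \<le> K" "norm (frechet_D (frechet_D F) x) \<le> K" for x
    using c(1)[of x] c(2)[of x] c(3)[of x] K(5-7) by linarith+
  have D2_lip: "norm (frechet_D (frechet_D F) x - frechet_D (frechet_D F) y) \<le> K * norm (x - y)" for x y
    by (rule Kp[OF blinfun_derivative_imp_lipschitz[OF der(3) c(4)] K(8) norm_ge_zero])
  interpret rough_equation \<alpha> T K tens X XX Z Z' F "frechet_D F" "frechet_D (frechet_D F)"
    by unfold_locales (fact assms(1) assms(4) K(1) chen driver Z'_K der(1,2) field_K D2_lip)+
  have sol: "controlled_solution tens \<alpha> X XX Z Z' F Y0 \<tau> Y Y' \<longleftrightarrow> controlled \<alpha> X \<tau> Y Y' \<and> solves \<tau> Y0 Y Y'"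
    for \<tau> Y Y'
    by (simp add: controlled_solution_def solves_def)
  \<comment> \<open>All larger constants are included, so that two solutions and \<open>K\<close>
    can share one \<open>M\<close>.\<close>
  have ctrl_ex: "\<exists>M. \<forall>M'\<ge>M. ctrl M' 0 \<tau> Y Y' \<and> incr M' 0 \<tau> Y"
    if Y: "controlled \<alpha> X \<tau> Y Y'" and \<tau>: "0 < \<tau>" "\<tau> \<le> T" for \<tau> and Y :: "real \<Rightarrow> 'w" and Y'
  proof -
    have X': "norm (X s t) \<le> CX * (t - s) powr \<alpha>" if "0 \<le> s" "s \<le> t" "t \<le> \<tau>" for s t
      using CX(2)[of s t] that \<tau> by simp
    obtain M where M: "\<And>t. \<lbrakk>0 \<le> t; t \<le> \<tau>\<rbrakk> \<Longrightarrow> norm (Y' t) \<le> M"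
      "\<And>s t. \<lbrakk>0 \<le> s; s \<le> t; t \<le> \<tau>\<rbrakk> \<Longrightarrow> norm (Y' t - Y' s) \<le> M * (t - s) powr \<alpha>"
      "\<And>s t. \<lbrakk>0 \<le> s; s \<le> t; t \<le> \<tau>\<rbrakk> \<Longrightarrow> norm (Y t - Y s) \<le> M * (t - s) powr \<alpha>"
      "\<And>s t. \<lbrakk>0 \<le> s; s \<le> t; t \<le> \<tau>\<rbrakk> \<Longrightarrow>
        norm (Y t - Y s - blinfun_apply (Y' s) (X s t)) \<le> M * ((t - s) powr \<alpha>)\<^sup>2"
      by (rule controlled_bounds[OF Y \<alpha> less_imp_le[OF \<tau>(1)] CX(1)])
        (rule X', assumption+, rule that, blast+)
    have le: "x \<le> M' * p" if "x \<le> M * p" "M \<le> M'" "0 \<le> p" for x p M'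
      using that mult_right_mono[of M M' p] by linarith
    have "ctrl M' 0 \<tau> Y Y' \<and> incr M' 0 \<tau> Y" if "M \<le> M'" for M'
      unfolding ctrl_def holder_ctrl_def incr_def rem_def
    proof (intro conjI allI impI)
      fix t assume "0 \<le> t \<and> t \<le> \<tau>"
      then show "norm (Y' t) \<le> M'" using M(1)[of t] that by simp
    next
      fix s t assume st: "0 \<le> s \<and> s \<le> t \<and> t \<le> \<tau>"
      show "norm (Y' t - Y' s) \<le> M' * (t - s) powr \<alpha>" by (rule le[OF M(2) that]) (use st in auto)
      show "norm (Y t - Y s) \<le> M' * (t - s) powr \<alpha>" by (rule le[OF M(3) that]) (use st in auto)
      show "norm (Y t - Y s - blinfun_apply (Y' s) (X s t)) \<le> M' * ((t - s) powr \<alpha>)\<^sup>2"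
        by (rule le[OF M(4) that]) (use st in auto)
    qed
    then show ?thesis by blast
  qed
  \<comment> \<open>The threshold depends on the data through \<open>K\<close>, \<alpha> and
    \<open>S\<close>, not on \<open>Y0\<close> or on a competing solution. The norms of a competitor
    only affect the number of steps inside \<open>solves_unique\<close>.\<close>
  have "0 < kappa ball_radius" using ball_radius_ge(4) by (intro kappa_pos) linarith
  then obtain h where h: "0 < h" "\<And>r. \<lbrakk>0 \<le> r; r \<le> h\<rbrakk> \<Longrightarrow> kappa ball_radius * r powr \<alpha> \<le> 1 / 2"
    using exists_small by blast
  show ?thesis
  proof (intro exI[of _ h] conjI h(1) allI impI)
    fix \<tau> assume "0 < \<tau> \<and> \<tau> < h \<and> \<tau> < T"
    then have \<tau>: "0 < \<tau>" "\<tau> \<le> h" "\<tau> \<le> T" by auto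
    obtain Y Y' where Y: "picard_ball \<tau> Y Y'" "solves \<tau> Y0 Y Y'"
      using solution_exists[OF \<tau>(1,3) h(2)] \<tau> by force
    have ctrlY: "controlled \<alpha> X \<tau> Y Y'"
      unfolding controlled_def
      using holder_ctrlD[OF ctrlD(2)[OF picard_ballD(1)[OF Y(1)]]] \<tau>
      by (intro conjI holder_finiteI[where C = ball_radius]) (auto simp: powr_double rem_def)
    show "\<exists>Y Y'. controlled_solution tens \<alpha> X XX Z Z' F Y0 \<tau> Y Y' \<and>
        (\<forall>V V'. controlled_solution tens \<alpha> X XX Z Z' F Y0 \<tau> V V' \<longrightarrow>
           (\<forall>t\<in>{0..\<tau>}. V t = Y t \<and> V' t = Y' t))"
    proof (intro exI[of _ Y] exI[of _ Y'] conjI allI impI ballI)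
      show "controlled_solution tens \<alpha> X XX Z Z' F Y0 \<tau> Y Y'" using ctrlY Y(2) by (simp add: sol)
    next
      fix V V' t assume V: "controlled_solution tens \<alpha> X XX Z Z' F Y0 \<tau> V V'" and t: "t \<in> {0..\<tau>}"
      then have V: "controlled \<alpha> X \<tau> V V'" "solves \<tau> Y0 V V'" by (simp_all add: sol)
      obtain M1 M2 where M: "\<And>M. M1 \<le> M \<Longrightarrow> ctrl M 0 \<tau> Y Y' \<and> incr M 0 \<tau> Y"
          "\<And>M. M2 \<le> M \<Longrightarrow> ctrl M 0 \<tau> V V' \<and> incr M 0 \<tau> V"
        using ctrl_ex[OF ctrlY \<tau>(1,3)] ctrl_ex[OF V(1) \<tau>(1,3)] by blast
      define M where "M = max K (max M1 M2)"
      have "ctrl M 0 \<tau> Y Y'" "incr M 0 \<tau> Y" "ctrl M 0 \<tau> V V'" "incr M 0 \<tau> V" "K \<le> M"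
        using M(1)[of M] M(2)[of M] by (auto simp: M_def)
      then show "V t = Y t" "V' t = Y' t"
        using solves_unique[OF V(2) _ _ Y(2), of M t] t \<tau> by auto
    qed
  qed
qed

end
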